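(* Let $\log$ denote $\log_2$. Then: (a) $\log \mathrm{ma}(\mathcal{B}_n) = (1+o(1))\binom{n-1}{\lfloor n/2\rfloor}$; (b) $\log \mathrm{mis}(Q_n) = (1+o(1))\,2^{n-2}$; (c) $\log \mathrm{mis}(\mathcal{B}_{n,k}) = (1+o(1))\binom{n-1}{k}$, where in each case $o(1)$ denotes a quantity tending to $0$ as $n\to\infty$ (in (c), uniformly over $0\le k\le n-1$). Equivalently: for every $\varepsilon>0$ there is $n_0$ such that for all $n\ge n_0$ and all $0\le k\le n-1$, each of the three quantities on the left lies between $(1-\varepsilon)$ and $(1+\varepsilon)$ times the corresponding quantity on the right.
   Context: $\mathcal{B}_n$ is the Boolean algebra of order $n$: the poset of all subsets of $\{1,\dots,n\}$ ordered by inclusion. An antichain of a poset is a set of pairwise incomparable elements; $\mathrm{ma}(P)$ is the number of maximal (with respect to inclusion) antichains of the poset $P$. For a graph $G$, $\mathrm{mis}(G)$ is the number of maximal (with respect to inclusion) independent sets of $G$. $Q_n$ is the graph with vertex set $\{0,1\}^n$ in which two vertices are adjacent iff they differ in exactly one coordinate. For $0\le k\le n-1$, $\mathcal{B}_{n,k}$ is the induced subgraph of $Q_n$ on the strings with exactly $k$ or exactly $k+1$ ones. *)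

theory Defs
  imports Complex_Main "HOL-Library.FuncSet" "HOL-Library.Ramsey" "HOL-Library.Landau_Symbols"
begin

definition maximal_members :: "'a set set \<Rightarrow> 'a set set" where
  "maximal_members F = {A \<in> F. \<forall>B\<in>F. A \<subseteq> B \<longrightarrow> B = A}"


text \<open>A poset is given by its carrier \<open>P\<close>, ordered by the order of the ambient type.\<close>

definition antichain :: "'a::order set \<Rightarrow> 'a set \<Rightarrow> bool" where
  "antichain P A \<longleftrightarrow> A \<subseteq> P \<and> pairwise (\<lambda>x y. \<not> x \<le> y \<and> \<not> y \<le> x) A"

definition ma :: "'a::order set \<Rightarrow> nat" where
  "ma P = card (maximal_members {A. antichain P A})"

definition boolean_algebra :: "nat \<Rightarrow> nat set set" where
  "boolean_algebra n = Pow {1..n}"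


text \<open>A graph is a pair of a vertex set and a set of two-element edges; \<^const>\<open>indep\<close> does not
  itself require its first argument to consist of vertices of the graph.\<close>

type_synonym 'a graph = "'a set \<times> 'a set set"

definition independent_set :: "'a graph \<Rightarrow> 'a set \<Rightarrow> bool" where
  "independent_set G A \<longleftrightarrow> A \<subseteq> fst G \<and> indep A (snd G)"

definition mis :: "'a graph \<Rightarrow> nat" where
  "mis G = card (maximal_members {A. independent_set G A})"

definition induced_subgraph :: "'a graph \<Rightarrow> 'a set \<Rightarrow> 'a graph" where
  "induced_subgraph G S = (fst G \<inter> S, {e \<in> snd G. e \<subseteq> S})"


text \<open>Strings in \<open>{0,1}\<^sup>n\<close> are functions on \<open>{1..n}\<close>, extended by \<^const>\<open>undefined\<close> so that
  equality of functions is equality of strings.\<close>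

definition strings :: "nat \<Rightarrow> (nat \<Rightarrow> nat) set" where
  "strings n = {1..n} \<rightarrow>\<^sub>E {0, 1}"

definition hypercube :: "nat \<Rightarrow> (nat \<Rightarrow> nat) graph" where
  "hypercube n =
    (strings n, {{x, y} | x y. x \<in> strings n \<and> y \<in> strings n \<and> (\<exists>!i. i \<in> {1..n} \<and> x i \<noteq> y i)})"

definition ones :: "nat \<Rightarrow> (nat \<Rightarrow> nat) \<Rightarrow> nat" where
  "ones n x = card {i \<in> {1..n}. x i = 1}"

definition two_layers :: "nat \<Rightarrow> nat \<Rightarrow> (nat \<Rightarrow> nat) graph" where
  "two_layers n k =
    induced_subgraph (hypercube n) {x \<in> strings n. ones n x = k \<or> ones n x = k + 1}"

end

theory Submission
  imports Defs "HOL-Real_Asymp.Real_Asymp" "HOL-Combinatorics.Multiset_Permutations"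
begin

text \<open>
  Each lower bound comes from an induced matching: pair \<open>A\<close> with \<open>A \<union> {u}\<close> for a fixed element \<open>u\<close>.

  For the upper bounds, branch on vertices of large degree until only low-degree induced subgraphs
  remain; this costs a factor \<open>2\<close> to the power of a lower-order term. In the two bipartite graphs a
  low-degree induced subgraph has one part of size at most about half the number of vertices
  (or \<open>(n - 1) choose k\<close>), and a maximal independent set is determined by its trace on that part.

  In the comparability graph of the Boolean algebra, the branching argument of Hujter and Tuza,
  which yields at most \<open>2\<close> to the power \<open>m / 2\<close> maximal independent sets on \<open>m\<close> vertices, is only
  obstructed by components that are triangles, that is, by isolated chains \<open>a \<subset> b \<subset> c\<close>. If the gap
  between \<open>a\<close> and \<open>c\<close> is bounded, a further element of the interval from \<open>a\<close> to \<open>c\<close> pays for the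
  triangle: such intervals add little to a low-degree family, which a double count of maximal
  chains bounds by about the middle binomial coefficient. Isolated chains with large gap are few by
  Sperner's theorem.
\<close>

section \<open>Counting maximal independent sets\<close>

text \<open>A triangle has three maximal independent sets and \<open>log 2 3 > 3 / 2\<close>, so
  half a bit per vertex is too little. Counting the short hull instead of the family adds a fourth
  set to a short triangle, and \<open>3 \<le> sqrt 2 ^ 4\<close>; a long triangle is granted one
  extra bit, and \<open>3 \<le> 2 * sqrt 2 ^ 3\<close>.

  The price is that degrees in the hull are only bounded by about the square of the cutoff, which is
  not \<open>o(n)\<close>. The chain count therefore separates covering pairs, of weight O(1/n)
  relative to one end, from all other comparable pairs, of relative weight O(1/n^2). Cover degrees
  in the hull stay linear in the cutoff, so both contributions vanish. The gap bound
  \<open>T\<close> is a constant fixed after \<epsilon>: it enters hull degrees as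
  \<open>2 ^ T\<close>, while long triangles cost a share \<open>1 / (T + 1)\<close> of the middle
  binomial coefficient.

  For two layers the obstacle is uniformity in \<open>k\<close>: near the ends the number of
  vertices is not bounded by a constant times the target, so branching is too expensive there, but
  one of the layers alone is then close enough to the target.\<close>

locale graph_rel =
  fixes E :: "'a \<Rightarrow> 'a \<Rightarrow> bool"
  assumes sym: "E x y \<Longrightarrow> E y x" and irrefl: "\<not> E x x"
begin

text \<open>Maximality appears as domination, the form in which branching uses it. \<open>E\<close>
  stays fixed and the vertex set is an argument, so passing to an induced subgraph only shrinks
  \<open>A\<close>.\<close>

definition max_indep :: "'a set \<Rightarrow> 'a set set" where
  "max_indep A = {I. I \<subseteq> A \<and> (\<forall>x\<in>I. \<forall>y\<in>I. \<not> E x y) \<and> (\<forall>x\<in>A - I. \<exists>y\<in>I. E x y)}"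

definition num :: "'a set \<Rightarrow> nat" where
  "num A = card (max_indep A)"

definition nbhd :: "'a set \<Rightarrow> 'a \<Rightarrow> 'a set" where
  "nbhd A v = {u\<in>A. E v u}"

definition cnbhd :: "'a set \<Rightarrow> 'a \<Rightarrow> 'a set" where
  "cnbhd A v = {u\<in>A. u = v \<or> E v u}"

lemma finite_max_indep: "finite A \<Longrightarrow> finite (max_indep A)"
  by (rule finite_subset[of _ "Pow A"]) (auto simp: max_indep_def)

lemma finite_nbhd [simp]: "finite A \<Longrightarrow> finite (nbhd A v)"
  by (simp add: nbhd_def)

lemma finite_cnbhd [simp]: "finite A \<Longrightarrow> finite (cnbhd A v)"
  by (simp add: cnbhd_def)

lemma card_cnbhd: "finite A \<Longrightarrow> v \<in> A \<Longrightarrow> card (cnbhd A v) = Suc (card (nbhd A v))"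
proof -
  assume "finite A" "v \<in> A"
  moreover have "cnbhd A v = insert v (nbhd A v)"
    using \<open>v \<in> A\<close> by (auto simp: cnbhd_def nbhd_def)
  moreover have "v \<notin> nbhd A v"
    by (simp add: nbhd_def irrefl)
  ultimately show ?thesis by simp
qed

lemma extend_max_indep:
  assumes "finite A" "I \<subseteq> A" "\<forall>x\<in>I. \<forall>y\<in>I. \<not> E x y"
  shows "\<exists>J\<in>max_indep A. I \<subseteq> J"
proof -
  define F where "F = {J. I \<subseteq> J \<and> J \<subseteq> A \<and> (\<forall>x\<in>J. \<forall>y\<in>J. \<not> E x y)}"
  have "finite F"
    by (rule finite_subset[of _ "Pow A"]) (auto simp: F_def assms)
  moreover have "I \<in> F"
    using assms by (simp add: F_def)
  ultimately obtain J where J: "J \<in> F" "I \<subseteq> J" "\<And>K. K \<in> F \<Longrightarrow> J \<subseteq> K \<Longrightarrow> K = J"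
    using finite_has_maximal2[of F I] by (metis)
  have "\<exists>y\<in>J. E x y" if "x \<in> A - J" for x
  proof (rule ccontr)
    assume *: "\<not> ?thesis"
    then have "insert x J \<in> F"
      using J(1) that sym irrefl unfolding F_def by blast
    then show False using J(3)[of "insert x J"] that by blast
  qed
  then have "J \<in> max_indep A"
    using J(1) by (auto simp: F_def max_indep_def)
  then show ?thesis using J(2) by blast
qed

text \<open>Deleting \<open>u\<close> loses no domination outside the closed neighbourhood of
  \<open>u\<close>, because \<open>u\<close> dominates nothing there.\<close>

lemma card_max_indep_containing:
  assumes "finite A" "u \<in> A"
  shows "card {I\<in>max_indep A. u \<in> I} \<le> num (A - cnbhd A u)"
  unfolding num_def
proof (rule card_inj_on_le)
  show "inj_on (\<lambda>I. I - {u}) {I \<in> max_indep A. u \<in> I}"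
    by (auto simp: inj_on_def)
  show "(\<lambda>I. I - {u}) ` {I \<in> max_indep A. u \<in> I} \<subseteq> max_indep (A - cnbhd A u)"
    unfolding max_indep_def cnbhd_def using sym by blast
  show "finite (max_indep (A - cnbhd A u))"
    using assms by (simp add: finite_max_indep)
qed

text \<open>A maximal independent set avoiding \<open>v\<close> stays maximal after \<open>v\<close>
  is deleted; one containing \<open>v\<close> excludes all its neighbours, so a vertex of large
  degree makes the second branch small.\<close>

lemma num_branch_vertex:
  assumes "finite A" "v \<in> A"
  shows "num A \<le> num (A - {v}) + num (A - cnbhd A v)"
proof -
  have "max_indep A \<subseteq> max_indep (A - {v}) \<union> {I\<in>max_indep A. v \<in> I}"
    unfolding max_indep_def by blast
  then have "num A \<le> card (max_indep (A - {v}) \<union> {I\<in>max_indep A. v \<in> I})"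
    unfolding num_def by (rule card_mono[rotated]) (use assms in \<open>simp add: finite_max_indep\<close>)
  also have "\<dots> \<le> card (max_indep (A - {v})) + card {I\<in>max_indep A. v \<in> I}"
    by (rule card_Un_le)
  finally show ?thesis
    using card_max_indep_containing[OF assms] unfolding num_def by linarith
qed

text \<open>Domination forces every maximal independent set to meet the closed neighbourhood of
  \<open>v\<close>. In this recursion of Hujter and Tuza every branch, unlike in
  \<open>num_branch_vertex\<close>, removes a whole closed neighbourhood.\<close>

lemma num_branch_nbhd:
  assumes "finite A" "v \<in> A"
  shows "num A \<le> (\<Sum>u\<in>cnbhd A v. num (A - cnbhd A u))"
proof -
  have "max_indep A \<subseteq> (\<Union>u\<in>cnbhd A v. {I\<in>max_indep A. u \<in> I})"
  proof
    fix I assume I: "I \<in> max_indep A"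
    show "I \<in> (\<Union>u\<in>cnbhd A v. {I\<in>max_indep A. u \<in> I})"
    proof (cases "v \<in> I")
      case True
      then show ?thesis using I assms by (auto simp: cnbhd_def)
    next
      case False
      then obtain y where "y \<in> I" "E v y" "y \<in> A"
        using I assms unfolding max_indep_def by blast
      then show ?thesis using I by (auto simp: cnbhd_def)
    qed
  qed
  then have "num A \<le> card (\<Union>u\<in>cnbhd A v. {I\<in>max_indep A. u \<in> I})"
    unfolding num_def by (rule card_mono[rotated]) (use assms in \<open>simp add: finite_max_indep\<close>)
  also have "\<dots> \<le> (\<Sum>u\<in>cnbhd A v. card {I\<in>max_indep A. u \<in> I})"
    by (rule card_UN_le) (simp add: assms)
  also have "\<dots> \<le> (\<Sum>u\<in>cnbhd A v. num (A - cnbhd A u))"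
    by (rule sum_mono, rule card_max_indep_containing) (auto simp: assms cnbhd_def)
  finally show ?thesis .
qed

text \<open>The trace on \<open>X\<close> determines a maximal independent set. If \<open>I\<close>
  and \<open>J\<close> have the same trace, a vertex of \<open>I - J\<close> lies outside
  \<open>X\<close>, and its neighbour in \<open>J\<close> can lie neither in \<open>X\<close>, where
  it would belong to \<open>I\<close> too, nor outside, where there are no edges.\<close>

lemma num_le_two_power_card:
  assumes "finite A" "X \<subseteq> A" "\<And>x y. x \<in> A - X \<Longrightarrow> y \<in> A - X \<Longrightarrow> \<not> E x y"
  shows "num A \<le> 2 ^ card X"
proof -
  have fX: "finite X" using assms finite_subset by blast
  have sub: "I \<subseteq> J" if I: "I \<in> max_indep A" and J: "J \<in> max_indep A" and eq: "I \<inter> X = J \<inter> X" for I J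
  proof
    fix x assume x: "x \<in> I"
    show "x \<in> J"
    proof (rule ccontr)
      assume "x \<notin> J"
      then obtain y where "y \<in> J" "E x y"
        using x I J unfolding max_indep_def by blast
      then show False
        using x \<open>x \<notin> J\<close> assms(3) I J eq unfolding max_indep_def by blast
    qed
  qed
  have "inj_on (\<lambda>I. I \<inter> X) (max_indep A)"
    by (rule inj_onI) (metis sub subset_antisym)
  then have "num A \<le> card (Pow X)"
    unfolding num_def by (rule card_inj_on_le) (auto simp: fX)
  then show ?thesis by (simp add: card_Pow fX)
qed

text \<open>Both branches at a vertex of degree at least \<open>\<phi>\<close> must fit into one
  factor \<open>1 + x\<close>. Deleting the vertex accounts for the summand 1, taking it into the
  set for \<open>x\<close>, since by hypothesis the loss of \<open>\<phi>\<close> further vertices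
  is worth a factor of at least \<open>1 / x\<close>.\<close>

lemma num_le_by_low_degree:
  assumes x: "x > 0" "x * (1 + x) ^ \<phi> \<ge> 1" and M: "M \<ge> 0"
    and low: "\<And>A. A \<subseteq> V \<Longrightarrow> (\<And>v. v \<in> A \<Longrightarrow> card (nbhd A v) < \<phi>) \<Longrightarrow> real (num A) \<le> M"
    and fin: "finite V"
  shows "real (num V) \<le> (1 + x) ^ card V * M"
proof -
  have "real (num A) \<le> (1 + x) ^ card A * M" if "A \<subseteq> V" for A
    using finite_subset[OF that fin] that
  proof (induction A rule: finite_psubset_induct)
    case (psubset A)
    show ?case
    proof (cases "\<exists>v\<in>A. card (nbhd A v) \<ge> \<phi>")
      case False
      then have "real (num A) \<le> 1 * M"
        using low[of A] psubset.prems by force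
      also have "\<dots> \<le> (1 + x) ^ card A * M"
        using x M by (intro mult_right_mono one_le_power) auto
      finally show ?thesis .
    next
      case True
      then obtain v where v: "v \<in> A" "card (nbhd A v) \<ge> \<phi>" by blast
      define c where "c = card A - 1"
      have cA: "card A = Suc c"
        using v psubset.hyps card_gt_0_iff[of A] unfolding c_def by auto
      have sub: "cnbhd A v \<subseteq> A" by (auto simp: cnbhd_def)
      have c1: "card (A - {v}) = c"
        using v psubset.hyps by (simp add: c_def)
      have cc: "card (cnbhd A v) = Suc (card (nbhd A v))"
        using v psubset.hyps by (simp add: card_cnbhd)
      have "card (A - cnbhd A v) = card A - card (cnbhd A v)"
        using psubset.hyps sub by (simp add: card_Diff_subset finite_subset)
      moreover have "card (cnbhd A v) \<le> card A"
        using psubset.hyps sub by (simp add: card_mono)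
      ultimately have c2: "card (A - cnbhd A v) + \<phi> \<le> c"
        using cc v(2) cA by linarith
      have "real (num A) \<le> real (num (A - {v})) + real (num (A - cnbhd A v))"
        using num_branch_vertex[OF psubset.hyps v(1)] by linarith
      also have "real (num (A - {v})) \<le> (1 + x) ^ c * M"
        using psubset.IH[of "A - {v}"] v psubset.prems c1 by auto
      also have "real (num (A - cnbhd A v)) \<le> (1 + x) ^ c * x * M"
      proof -
        have "v \<in> cnbhd A v" using v by (simp add: cnbhd_def)
        then have "A - cnbhd A v \<subset> A" using v by blast
        then have "real (num (A - cnbhd A v)) \<le> (1 + x) ^ card (A - cnbhd A v) * M"
          using psubset.IH[of "A - cnbhd A v"] psubset.prems by blast
        also have "\<dots> \<le> (1 + x) ^ card (A - cnbhd A v) * (x * (1 + x) ^ \<phi>) * M"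
          using x M by (intro mult_right_mono) (auto simp: mult_le_cancel_left1)
        also have "\<dots> = x * (1 + x) ^ (card (A - cnbhd A v) + \<phi>) * M"
          by (simp add: power_add)
        also have "\<dots> \<le> x * (1 + x) ^ c * M"
          using x M c2 by (intro mult_right_mono mult_left_mono power_increasing) auto
        finally show ?thesis by (simp add: mult_ac)
      qed
      finally show ?thesis by (simp add: cA algebra_simps)
    qed
  qed
  then show ?thesis by blast
qed

text \<open>Choosing one end of each matching edge gives an independent set. The choice can be read
  off any extension: where it takes \<open>b i\<close>, the edge keeps \<open>a i\<close>
  out.\<close>

lemma num_ge_induced_matching:
  assumes "finite V" "finite J" "\<And>i. i \<in> J \<Longrightarrow> a i \<in> V \<and> b i \<in> V \<and> E (a i) (b i)"
    and ind: "\<And>i j. i \<in> J \<Longrightarrow> j \<in> J \<Longrightarrow> i \<noteq> j \<Longrightarrow> a i \<noteq> a j \<and> \<not> E (a i) (a j) \<and> \<not> E (a i) (b j) \<and> \<not> E (b i) (b j)"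
  shows "2 ^ card J \<le> num V"
proof -
  define g where "g S = a ` S \<union> b ` (J - S)" for S
  define f where "f S = (SOME I. I \<in> max_indep V \<and> g S \<subseteq> I)" for S
  have f: "f S \<in> max_indep V \<and> g S \<subseteq> f S" if "S \<subseteq> J" for S
  proof -
    have "\<not> E u v" if "u \<in> g S" "v \<in> g S" for u v
      using that \<open>S \<subseteq> J\<close> ind sym irrefl unfolding g_def by blast
    moreover have "g S \<subseteq> V" using that assms(3) unfolding g_def by blast
    ultimately have "\<exists>I. I \<in> max_indep V \<and> g S \<subseteq> I"
      using extend_max_indep[OF assms(1), of "g S"] by blast
    then show ?thesis unfolding f_def by (rule someI_ex)
  qed
  have rec: "{i\<in>J. a i \<in> f S} = S" if "S \<subseteq> J" for S
  proof -
    have "i \<in> S" if "i \<in> J" "a i \<in> f S" for i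
    proof (rule ccontr)
      assume "i \<notin> S"
      then have "b i \<in> f S" using f[OF \<open>S \<subseteq> J\<close>] that unfolding g_def by blast
      then show False
        using f[OF \<open>S \<subseteq> J\<close>] that assms(3) unfolding max_indep_def by blast
    qed
    moreover have "a i \<in> f S" if "i \<in> S" for i
      using f[OF \<open>S \<subseteq> J\<close>] that unfolding g_def by blast
    ultimately show ?thesis using that by blast
  qed
  have "inj_on f (Pow J)"
    by (rule inj_onI) (metis rec PowD)
  then have "card (Pow J) \<le> num V"
    unfolding num_def by (rule card_inj_on_le) (use f finite_max_indep[OF assms(1)] in auto)
  then show ?thesis by (simp add: card_Pow assms(2))
qed

section \<open>Low-degree subgraphs of biregular bipartite graphs\<close>

text \<open>Double counting of the edges between \<open>A\<close> and \<open>Y - B\<close>: each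
  vertex of \<open>A\<close> sends at least \<open>p - \<phi>\<close> of them, each vertex of
  \<open>Y - B\<close> receives at most \<open>q\<close>, and \<open>B\<close> is at least as large
  as \<open>A\<close>.\<close>

lemma low_degree_min_part:
  assumes fin: "finite X" "finite Y"
    and p: "\<And>x. x \<in> X \<Longrightarrow> card (nbhd Y x) = p" and q: "\<And>y. y \<in> Y \<Longrightarrow> card (nbhd X y) = q"
    and A: "A \<subseteq> X" "B \<subseteq> Y" "card A \<le> card B"
    and low: "\<And>v. v \<in> A \<Longrightarrow> card (nbhd B v) \<le> \<phi>"
  shows "card A * (p + q) \<le> q * card Y + \<phi> * card A"
proof -
  have finA: "finite A" "finite B" using A fin finite_subset by blast+
  have "card A * p = (\<Sum>x\<in>A. card (nbhd Y x))"
    using p A by (simp add: subset_iff)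
  also have "\<dots> = (\<Sum>x\<in>A. card (nbhd B x) + card (nbhd (Y - B) x))"
  proof (rule sum.cong)
    fix x assume "x \<in> A"
    have "nbhd Y x = nbhd B x \<union> nbhd (Y - B) x" "nbhd B x \<inter> nbhd (Y - B) x = {}"
      using A by (auto simp: nbhd_def)
    then show "card (nbhd Y x) = card (nbhd B x) + card (nbhd (Y - B) x)"
      using fin finA by (simp add: card_Un_disjoint)
  qed simp
  also have "\<dots> = (\<Sum>x\<in>A. card (nbhd B x)) + (\<Sum>x\<in>A. card (nbhd (Y - B) x))"
    by (rule sum.distrib)
  also have "(\<Sum>x\<in>A. card (nbhd B x)) \<le> \<phi> * card A"
    using sum_mono[of A "\<lambda>x. card (nbhd B x)" "\<lambda>_. \<phi>"] low by (simp add: mult.commute)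
  also have "(\<Sum>x\<in>A. card (nbhd (Y - B) x)) = (\<Sum>y\<in>Y - B. card {x\<in>A. E x y})"
    unfolding nbhd_def by (rule sum_multicount_gen) (use fin finA in auto)
  also have "\<dots> \<le> (\<Sum>y\<in>Y - B. q)"
  proof (rule sum_mono)
    fix y assume "y \<in> Y - B"
    then have "card {x\<in>A. E x y} \<le> card (nbhd X y)"
      by (intro card_mono) (use A fin sym in \<open>auto simp: nbhd_def\<close>)
    then show "card {x\<in>A. E x y} \<le> q" using q \<open>y \<in> Y - B\<close> by simp
  qed
  also have "\<dots> = q * (card Y - card B)"
    using A finA by (simp add: card_Diff_subset mult.commute)
  finally have "card A * p \<le> \<phi> * card A + q * (card Y - card B)" by simp
  moreover have "q * (card Y - card B) + q * card A \<le> q * card Y"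
    using A(3) card_mono[OF fin(2) A(2)]
    by (metis add_le_cancel_left distrib_left le_add_diff_inverse2 mult_le_mono2)
  ultimately show ?thesis by (simp add: algebra_simps)
qed

text \<open>\<open>p * card X\<close> is the number of edges. In a low-degree induced subgraph the
  smaller side has at most this number divided by \<open>p + q - \<phi>\<close> vertices, and the
  trace on that side determines a maximal independent set.\<close>

lemma num_biregular_le:
  assumes fin: "finite X" "finite Y" and disj: "X \<inter> Y = {}"
    and p: "\<And>x. x \<in> X \<Longrightarrow> card (nbhd Y x) = p" and q: "\<And>y. y \<in> Y \<Longrightarrow> card (nbhd X y) = q"
    and indep: "\<And>x y. x \<in> X \<Longrightarrow> y \<in> X \<Longrightarrow> \<not> E x y" "\<And>x y. x \<in> Y \<Longrightarrow> y \<in> Y \<Longrightarrow> \<not> E x y"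
    and x: "x > 0" "x * (1 + x) ^ \<phi> \<ge> 1" and \<phi>: "\<phi> < p + q"
  shows "real (num (X \<union> Y)) \<le> (1 + x) ^ (card X + card Y) *
           2 powr (real (p * card X) / real (p + q - \<phi>))"
proof -
  have pq: "p * card X = q * card Y"
  proof -
    have "(\<Sum>x\<in>X. card {y\<in>Y. E x y}) = (\<Sum>y\<in>Y. card {x\<in>X. E x y})"
      by (rule sum_multicount_gen) (use fin in auto)
    moreover have "(\<Sum>x\<in>X. card {y\<in>Y. E x y}) = (\<Sum>x\<in>X. p)"
      using p by (intro sum.cong) (auto simp: nbhd_def)
    moreover have "(\<Sum>y\<in>Y. card {x\<in>X. E x y}) = (\<Sum>y\<in>Y. q)"
    proof (intro sum.cong refl)
      fix y assume "y \<in> Y"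
      moreover have "{x\<in>X. E x y} = nbhd X y" using sym by (auto simp: nbhd_def)
      ultimately show "card {x\<in>X. E x y} = q" using q by simp
    qed
    ultimately show ?thesis by (simp add: mult.commute)
  qed
  let ?c = "p * card X"
  have "real (num (X \<union> Y)) \<le> (1 + x) ^ card (X \<union> Y) * 2 powr (real ?c / real (p + q - \<phi>))"
  proof (rule num_le_by_low_degree[OF x])
    fix C assume C: "C \<subseteq> X \<union> Y" and low: "\<And>v. v \<in> C \<Longrightarrow> card (nbhd C v) < \<phi>"
    have finC: "finite C" using C fin finite_subset by blast
    define A where "A = C \<inter> X"
    define B where "B = C \<inter> Y"
    have low': "card (nbhd B' v) \<le> \<phi>" if "v \<in> C" "B' \<subseteq> C" for v B'
    proof -
      have "card (nbhd B' v) \<le> card (nbhd C v)"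
        using that finC by (intro card_mono) (auto simp: nbhd_def)
      then show ?thesis using low[OF that(1)] by simp
    qed
    have final: "real (num C) \<le> 2 powr (real ?c / real (p + q - \<phi>))"
      if "D \<subseteq> C" "\<And>x y. x \<in> C - D \<Longrightarrow> y \<in> C - D \<Longrightarrow> \<not> E x y"
        "card D * (p + q) \<le> ?c + \<phi> * card D" for D
    proof -
      have "num C \<le> 2 ^ card D"
        using num_le_two_power_card[OF finC that(1,2)] by blast
      then have "real (num C) \<le> 2 powr real (card D)"
        by (metis (mono_tags, lifting) numeral_power_le_of_nat_cancel_iff of_nat_le_iff of_nat_numeral of_nat_power powr_realpow zero_less_numeral)
      also have "real (card D) \<le> real ?c / real (p + q - \<phi>)"
      proof -
        have "card D * (p + q - \<phi>) \<le> ?c"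
          using that(3) by (simp add: algebra_simps diff_mult_distrib2)
        then have "real (card D) * real (p + q - \<phi>) \<le> real ?c"
          by (metis of_nat_le_iff of_nat_mult)
        moreover have "real (p + q - \<phi>) > 0" using \<phi> by simp
        ultimately show ?thesis by (simp only: pos_le_divide_eq)
      qed
      finally show ?thesis by simp
    qed
    show "real (num C) \<le> 2 powr (real ?c / real (p + q - \<phi>))"
    proof (cases "card A \<le> card B")
      case True
      have "card A * (p + q) \<le> q * card Y + \<phi> * card A"
        by (rule low_degree_min_part[OF fin p q _ _ True]) (auto simp: A_def B_def intro!: low')
      then have "card A * (p + q) \<le> ?c + \<phi> * card A" by (simp only: pq)
      moreover have "A \<subseteq> C" "C - A \<subseteq> Y" using C by (auto simp: A_def)
      ultimately show ?thesis
        using final[of A] indep(2) by blast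
    next
      case False
      have "card B * (q + p) \<le> p * card X + \<phi> * card B"
        by (rule low_degree_min_part[OF fin(2,1) q p, of B A]) (use False in \<open>auto simp: A_def B_def intro!: low'\<close>)
      then have "card B * (p + q) \<le> ?c + \<phi> * card B" by (simp only: add.commute)
      moreover have "B \<subseteq> C" "C - B \<subseteq> X" using C by (auto simp: B_def)
      ultimately show ?thesis
        using final[of B] indep(1) by blast
    qed
  qed (use fin in auto)
  then show ?thesis using fin disj by (simp add: card_Un_disjoint)
qed

end

section \<open>An inequality of LYM type\<close>

text \<open>A permutation of \<open>U\<close> encodes a maximal chain of subsets, the sets of its
  prefixes; the predicate says that this chain passes through \<open>x\<close>.\<close>

definition is_prefix_set :: "'a list \<Rightarrow> 'a set \<Rightarrow> bool" where
  "is_prefix_set xs x \<longleftrightarrow> set (take (card x) xs) = x"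

text \<open>Cut the permutation after \<open>card y\<close> entries. The predicate \<open>Q\<close>
  on the first part allows a second cut, which gives the count for two nested sets.\<close>

lemma card_permutations_prefix:
  assumes "finite U" "y \<subseteq> U"
  shows "card {xs \<in> permutations_of_set U. is_prefix_set xs y \<and> Q (take (card y) xs)} =
           card {xs \<in> permutations_of_set y. Q xs} * fact (card U - card y)"
proof -
  have finy: "finite y" using assms finite_subset by blast
  let ?S = "{xs \<in> permutations_of_set y. Q xs} \<times> permutations_of_set (U - y)"
  have "{xs \<in> permutations_of_set U. is_prefix_set xs y \<and> Q (take (card y) xs)} = (\<lambda>(a, b). a @ b) ` ?S"
    (is "?L = _")
  proof
    show "?L \<subseteq> (\<lambda>(a, b). a @ b) ` ?S"
    proof
      fix xs assume xs: "xs \<in> ?L"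
      let ?a = "take (card y) xs" and ?b = "drop (card y) xs"
      have d: "distinct (?a @ ?b)" "set (?a @ ?b) = U" "set ?a = y"
        using xs by (auto simp: permutations_of_set_def is_prefix_set_def)
      then have "set ?b = U - y" unfolding distinct_append set_append by blast
      then have "(?a, ?b) \<in> ?S"
        using xs d unfolding permutations_of_set_def by auto
      then show "xs \<in> (\<lambda>(a, b). a @ b) ` ?S"
        by (force intro: image_eqI[of _ _ "(?a, ?b)"])
    qed
    show "(\<lambda>(a, b). a @ b) ` ?S \<subseteq> ?L"
    proof clarify
      fix a b assume a: "a \<in> permutations_of_set y" "Q a" and b: "b \<in> permutations_of_set (U - y)"
      have "length a = card y" using a(1) by (rule length_finite_permutations_of_set)
      then show "a @ b \<in> permutations_of_set U \<and> is_prefix_set (a @ b) y \<and> Q (take (card y) (a @ b))"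
        using a b assms by (auto simp: permutations_of_set_def is_prefix_set_def)
    qed
  qed
  moreover have "inj_on (\<lambda>(a, b). a @ b) ?S"
    by (auto simp: inj_on_def dest!: length_finite_permutations_of_set)
  ultimately have "card ?L = card ?S" by (simp add: card_image)
  also have "\<dots> = card {xs \<in> permutations_of_set y. Q xs} * fact (card U - card y)"
    using assms finy by (simp add: card_cartesian_product card_Diff_subset)
  finally show ?thesis .
qed

text \<open>The number of maximal chains through \<open>x\<close> in the subsets of an
  \<open>n\<close>-element set; \<open>pair_weight\<close> is the number of those through two nested
  sets.\<close>

definition chain_weight :: "nat \<Rightarrow> 'a set \<Rightarrow> nat" where
  "chain_weight n x = fact (card x) * fact (n - card x)"

definition pair_weight :: "nat \<Rightarrow> 'a set \<Rightarrow> 'a set \<Rightarrow> nat" where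
  "pair_weight n x y = fact (card x) * fact (card y - card x) * fact (n - card y)"

lemma card_permutations_through:
  assumes "finite U" "x \<subseteq> U"
  shows "card {xs \<in> permutations_of_set U. is_prefix_set xs x} = chain_weight (card U) x"
proof -
  have "{xs \<in> permutations_of_set x. True} = permutations_of_set x" by simp
  then show ?thesis
    using card_permutations_prefix[OF assms, of "\<lambda>_. True"] finite_subset[OF assms(2,1)]
    by (simp add: chain_weight_def)
qed

lemma card_permutations_through_pair:
  assumes "finite U" "x \<subseteq> y" "y \<subseteq> U"
  shows "card {xs \<in> permutations_of_set U. is_prefix_set xs x \<and> is_prefix_set xs y} = pair_weight (card U) x y"
proof -
  have fin: "finite y" using assms finite_subset by blast
  have "card x \<le> card y" using fin assms by (simp add: card_mono)
  then have "is_prefix_set (take (card y) xs) x \<longleftrightarrow> is_prefix_set xs x" for xs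
    by (simp add: is_prefix_set_def min_def)
  then have "{xs \<in> permutations_of_set U. is_prefix_set xs x \<and> is_prefix_set xs y} =
      {xs \<in> permutations_of_set U. is_prefix_set xs y \<and> is_prefix_set (take (card y) xs) x}"
    by auto
  then show ?thesis
    using card_permutations_prefix[OF assms(1,3), of "\<lambda>xs. is_prefix_set xs x"]
      card_permutations_through[OF fin assms(2)]
    by (simp add: chain_weight_def pair_weight_def)
qed

text \<open>The pairs whose lower end is the smallest member already number
  \<open>card C - 1\<close>.\<close>

lemma card_chain_le_pairs:
  assumes "finite C" "\<And>x y. x \<in> C \<Longrightarrow> y \<in> C \<Longrightarrow> card x \<le> card y \<Longrightarrow> x \<subseteq> y"
  shows "card C \<le> 1 + card {(x, y) \<in> C \<times> C. x \<subset> y}"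
proof (cases "C = {}")
  case False
  obtain x where x: "x \<in> C" "\<And>y. y \<in> C \<Longrightarrow> card x \<le> card y"
    using ex_has_least_nat[of "\<lambda>x. x \<in> C" _ card] False by blast
  have "card (C - {x}) \<le> card {(x, y) \<in> C \<times> C. x \<subset> y}"
  proof (rule card_inj_on_le)
    show "inj_on (Pair x) (C - {x})" by (simp add: inj_on_def)
    show "Pair x ` (C - {x}) \<subseteq> {(x, y) \<in> C \<times> C. x \<subset> y}"
      using x assms(2) by auto
    show "finite {(x, y) \<in> C \<times> C. x \<subset> y}"
      by (rule finite_subset[of _ "C \<times> C"]) (use assms in auto)
  qed
  then show ?thesis using x(1) assms(1) by (simp add: card_Diff_singleton)
qed simp

text \<open>On one permutation the members that are prefixes form a chain, so
  \<open>card_chain_le_pairs\<close> applies. Summed over all permutations, its constant 1 becomes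
  \<open>fact (card U)\<close> and its pairs become the correction term, which vanishes for an
  antichain and leaves the LYM inequality.\<close>

lemma LYM_with_pairs:
  assumes "finite U" "F \<subseteq> Pow U"
  shows "(\<Sum>x\<in>F. chain_weight (card U) x) \<le>
           fact (card U) + (\<Sum>(x, y)\<in>{(x, y) \<in> F \<times> F. x \<subset> y}. pair_weight (card U) x y)"
proof -
  let ?L = "permutations_of_set U"
  let ?P = "{(x, y) \<in> F \<times> F. x \<subset> y}"
  have finF: "finite F" using assms by (meson finite_Pow_iff finite_subset)
  have finP: "finite ?P" by (rule finite_subset[of _ "F \<times> F"]) (use finF in auto)
  have finL: "finite ?L" by simp
  have one: "(\<Sum>xs\<in>?L. card {x\<in>F. is_prefix_set xs x}) = (\<Sum>x\<in>F. chain_weight (card U) x)"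
    by (rule sum_multicount_gen[OF finL finF]) (use assms in \<open>auto simp: card_permutations_through\<close>)
  have two: "(\<Sum>xs\<in>?L. card {p\<in>?P. is_prefix_set xs (fst p) \<and> is_prefix_set xs (snd p)}) =
      (\<Sum>p\<in>?P. pair_weight (card U) (fst p) (snd p))"
    by (rule sum_multicount_gen[OF finL finP])
      (use assms in \<open>auto simp: card_permutations_through_pair\<close>)
  have "(\<Sum>xs\<in>?L. card {x\<in>F. is_prefix_set xs x}) \<le>
      (\<Sum>xs\<in>?L. 1 + card {p\<in>?P. is_prefix_set xs (fst p) \<and> is_prefix_set xs (snd p)})"
  proof (rule sum_mono)
    fix xs
    let ?C = "{x\<in>F. is_prefix_set xs x}"
    have "card ?C \<le> 1 + card {(x, y) \<in> ?C \<times> ?C. x \<subset> y}"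
    proof (rule card_chain_le_pairs)
      fix x y assume "x \<in> ?C" "y \<in> ?C" "card x \<le> card y"
      then show "x \<subseteq> y"
        unfolding is_prefix_set_def by (metis (mono_tags, lifting) mem_Collect_eq set_take_subset_set_take)
    qed (use finF in simp)
    also have "{(x, y) \<in> ?C \<times> ?C. x \<subset> y} =
        {p\<in>?P. is_prefix_set xs (fst p) \<and> is_prefix_set xs (snd p)}" by auto
    finally show "card ?C \<le> 1 + card {p\<in>?P. is_prefix_set xs (fst p) \<and> is_prefix_set xs (snd p)}" .
  qed
  then show ?thesis
    unfolding one sum.distrib two using assms(1) by (simp add: case_prod_unfold)
qed

lemma fact_le_chain_weight:
  assumes "finite U" "x \<subseteq> U"
  shows "fact (card U) \<le> chain_weight (card U) x * (card U choose (card U div 2))"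
proof -
  have "card x \<le> card U" using assms by (simp add: card_mono)
  then have "fact (card U) = chain_weight (card U) x * (card U choose card x)"
    unfolding chain_weight_def by (simp add: binomial_fact_lemma)
  then show ?thesis using binomial_maximum by simp
qed

lemma Sperner:
  assumes "finite U" "F \<subseteq> Pow U" "\<And>x y. x \<in> F \<Longrightarrow> y \<in> F \<Longrightarrow> \<not> x \<subset> y"
  shows "card F \<le> card U choose (card U div 2)"
proof -
  let ?N = "card U choose (card U div 2)"
  have "card F * fact (card U) \<le> (\<Sum>x\<in>F. chain_weight (card U) x * ?N)"
  proof -
    have "(\<Sum>x\<in>F. fact (card U)) \<le> (\<Sum>x\<in>F. chain_weight (card U) x * ?N)"
      by (rule sum_mono, rule fact_le_chain_weight[OF assms(1)]) (use assms(2) in blast)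
    then show ?thesis by simp
  qed
  also have "\<dots> = (\<Sum>x\<in>F. chain_weight (card U) x) * ?N"
    by (simp add: sum_distrib_right)
  also have "\<dots> \<le> fact (card U) * ?N"
  proof -
    have "{(x, y) \<in> F \<times> F. x \<subset> y} = {}" using assms(3) by auto
    from LYM_with_pairs[OF assms(1,2), unfolded this]
    have "(\<Sum>x\<in>F. chain_weight (card U) x) \<le> fact (card U)" by simp
    then show ?thesis by (rule mult_le_mono1)
  qed
  finally show ?thesis by simp
qed

section \<open>Low-degree families and the middle binomial coefficient\<close>

text \<open>Separates covering pairs, \<open>s = 1\<close>, from the rest: for
  \<open>2 \<le> s \<le> m - 2\<close> the coefficient is at least \<open>m choose 2\<close>, hence
  quadratic in \<open>n\<close>.\<close>

lemma inverse_choose_le: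
  fixes n m s :: nat
  assumes "n \<ge> 4" "n \<le> 2 * m" "1 \<le> s" "s + 2 \<le> m"
  shows "1 / real (m choose s) \<le> 2 / real n * of_bool (s = 1) + 16 / (real n)\<^sup>2"
proof (cases "s = 1")
  case True
  have "1 / real m \<le> 2 / real n" using assms by (simp add: divide_simps)
  then show ?thesis using True by (simp add: add_increasing2)
next
  case False
  then have s: "s \<ge> 2" using assms by simp
  have "m choose 2 \<le> m choose s"
  proof (cases "2 * s \<le> m")
    case True
    then show ?thesis using s by (intro binomial_mono)
  next
    case False
    then have "m choose 2 \<le> m choose (m - s)" using assms by (intro binomial_mono) auto
    then show ?thesis using assms binomial_symmetric[of s m] by simp
  qed
  moreover have "(real n)\<^sup>2 / 16 \<le> real (m choose 2)"
  proof -
    have "real (m choose 2) = real m * (real m - 1) / 2"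
      using assms by (simp add: choose_two real_of_nat_div of_nat_diff)
    \<comment> \<open>From \<open>m \<ge> n / 2\<close> and \<open>n \<ge> 4\<close> follows
      \<open>m - 1 \<ge> n / 4\<close>.\<close>
    moreover have "(real n / 2) * (real n / 4) \<le> real m * (real m - 1)"
      using assms by (intro mult_mono) auto
    ultimately show ?thesis by (simp add: power2_eq_square)
  qed
  ultimately have *: "(real n)\<^sup>2 / 16 \<le> real (m choose s)" by linarith
  then have "1 / real (m choose s) \<le> 1 / ((real n)\<^sup>2 / 16)"
    using assms by (intro divide_left_mono) auto
  then show ?thesis using False by simp
qed

text \<open>Let \<open>n = card U\<close> and \<open>s = card y - card x\<close>. A random maximal
  chain through \<open>x\<close> meets \<open>y\<close> with probability
  \<open>1 / ((n - card x) choose s)\<close>, and one through \<open>y\<close> meets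
  \<open>x\<close> with probability \<open>1 / (card y choose s)\<close>. One of the two upper
  indices is at least \<open>n / 2\<close>. Charging both ends spares later sums this case
  distinction.\<close>

lemma pair_weight_le:
  assumes "finite U" "x \<subset> y" "y \<subseteq> U" "card U \<ge> 4" "2 \<le> card x" "card y + 2 \<le> card U"
  defines "b \<equiv> 2 / real (card U) * of_bool (card y - card x = 1) + 16 / (real (card U))\<^sup>2"
  shows "real (pair_weight (card U) x y) \<le>
    real (chain_weight (card U) x) * b + real (chain_weight (card U) y) * b"
proof -
  let ?n = "card U" and ?s = "card y - card x"
  have fin: "finite y" using assms finite_subset by blast
  have xy: "card x < card y" using fin assms(2) by (rule psubset_card_mono)
  have yn: "card y \<le> ?n" using assms by linarith
  have b: "b \<ge> 0" unfolding b_def by simp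
  have up: "real (pair_weight ?n x y) = real (chain_weight ?n x) * (1 / real ((?n - card x) choose ?s))"
  proof -
    have "fact ?s * fact (?n - card x - ?s) * ((?n - card x) choose ?s) = (fact (?n - card x) :: nat)"
      using xy yn by (intro binomial_fact_lemma) simp
    moreover have "?n - card x - ?s = ?n - card y" using xy yn by simp
    ultimately have "pair_weight ?n x y * ((?n - card x) choose ?s) = chain_weight ?n x"
      unfolding pair_weight_def chain_weight_def by (simp add: mult_ac)
    moreover have "(?n - card x) choose ?s > 0" using xy yn by (simp add: zero_less_binomial_iff)
    ultimately show ?thesis by (simp add: field_simps flip: of_nat_mult)
  qed
  have down: "real (pair_weight ?n x y) = real (chain_weight ?n y) * (1 / real (card y choose ?s))"
  proof -
    have "fact ?s * fact (card y - ?s) * (card y choose ?s) = (fact (card y) :: nat)"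
      by (intro binomial_fact_lemma) simp
    moreover have "card y - ?s = card x" using xy by simp
    ultimately have "pair_weight ?n x y * (card y choose ?s) = chain_weight ?n y"
      unfolding pair_weight_def chain_weight_def by (metis mult.commute mult.left_commute)
    moreover have "card y choose ?s > 0" by (simp add: zero_less_binomial_iff)
    ultimately show ?thesis by (simp add: field_simps flip: of_nat_mult)
  qed
  show ?thesis
  proof (cases "2 * card x \<le> ?n")
    case True
    have "1 / real ((?n - card x) choose ?s) \<le> b"
      unfolding b_def by (rule inverse_choose_le) (use assms xy True in linarith)+
    then have "real (pair_weight ?n x y) \<le> real (chain_weight ?n x) * b"
      unfolding up by (intro mult_left_mono) auto
    then show ?thesis using b by (simp add: add_increasing2)
  next
    case False
    have "1 / real (card y choose ?s) \<le> b"
      unfolding b_def by (rule inverse_choose_le) (use assms xy False in linarith)+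
    then have "real (pair_weight ?n x y) \<le> real (chain_weight ?n y) * b"
      unfolding down by (intro mult_left_mono) auto
    then show ?thesis using b by (simp add: add_increasing)
  qed
qed

text \<open>Every comparable pair is charged to its two ends. A member receives at most
  \<open>\<kappa>\<close> times its own weight from the pairs above it and the same from those
  below, so at least the share \<open>1 - 2 * \<kappa>\<close> of the LYM sum survives. With
  separate degrees for covers, \<open>d\<^sub>1 = o(n)\<close> and \<open>d\<^sub>2 = o(n^2)\<close>
  suffice.\<close>

lemma card_low_degree_family:
  fixes F :: "'a set set"
  assumes U: "finite U" "card U \<ge> 4"
    and F: "\<And>x. x \<in> F \<Longrightarrow> x \<subseteq> U \<and> 2 \<le> card x \<and> card x + 2 \<le> card U"
    and up: "\<And>x. x \<in> F \<Longrightarrow> card {y\<in>F. x \<subset> y \<and> card y = card x + 1} \<le> d\<^sub>1"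
      "\<And>x. x \<in> F \<Longrightarrow> card {y\<in>F. x \<subset> y} \<le> d\<^sub>2"
    and down: "\<And>y. y \<in> F \<Longrightarrow> card {x\<in>F. x \<subset> y \<and> card y = card x + 1} \<le> d\<^sub>1"
      "\<And>y. y \<in> F \<Longrightarrow> card {x\<in>F. x \<subset> y} \<le> d\<^sub>2"
  defines "\<kappa> \<equiv> 2 * real d\<^sub>1 / real (card U) + 16 * real d\<^sub>2 / (real (card U))\<^sup>2"
  shows "(1 - 2 * \<kappa>) * real (card F) \<le> real (card U choose (card U div 2))"
proof (cases "1 - 2 * \<kappa> \<ge> 0")
  case False
  then have "(1 - 2 * \<kappa>) * real (card F) \<le> 0"
    by (intro mult_nonpos_nonneg) auto
  then show ?thesis by (rule order_trans) simp
next
  case True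
  let ?n = "card U"
  let ?N = "?n choose (?n div 2)"
  let ?P = "{(x, y) \<in> F \<times> F. x \<subset> y}"
  have FU: "F \<subseteq> Pow U" using F by blast
  have finF: "finite F" using FU U by (meson finite_Pow_iff finite_subset)
  define w where "w x = real (chain_weight ?n x)" for x :: "'a set"
  define b where "b x y = 2 / real ?n * of_bool (card y - card x = 1) + 16 / (real ?n)\<^sup>2" for x y :: "'a set"
  have cardpos: "card y - card x = 1 \<longleftrightarrow> card y = card x + 1" for x y :: "'a set" by linarith
  \<comment> \<open>Stated for arbitrary \<open>f\<close> and \<open>g\<close> so that it serves
    both the pairs above a fixed lower end and the pairs below a fixed upper end.\<close>
  have sum_b: "(\<Sum>z\<in>{z\<in>F. R z}. b (f z) (g z)) \<le> \<kappa>"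
    if "card {z\<in>F. R z \<and> card (g z) = card (f z) + 1} \<le> d\<^sub>1" "card {z\<in>F. R z} \<le> d\<^sub>2" for R f g
  proof -
    have "(\<Sum>z\<in>{z\<in>F. R z}. b (f z) (g z)) =
      2 / real ?n * real (card {z\<in>F. R z \<and> card (g z) = card (f z) + 1}) + 16 / (real ?n)\<^sup>2 * real (card {z\<in>F. R z})"
    proof -
      have "(\<Sum>z\<in>{z\<in>F. R z}. of_bool (card (g z) = card (f z) + 1) :: real) =
          real (card {z\<in>F. R z \<and> card (g z) = card (f z) + 1})"
        using finF by (simp add: of_bool_def sum.If_cases Int_def conj_assoc)
      then show ?thesis
        unfolding b_def cardpos sum.distrib sum_distrib_left[symmetric] by (simp add: sum_constant)
    qed
    also have "\<dots> \<le> 2 / real ?n * real d\<^sub>1 + 16 / (real ?n)\<^sup>2 * real d\<^sub>2"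
      using that by (intro add_mono mult_left_mono) auto
    finally show ?thesis unfolding \<kappa>_def by simp
  qed
  have "(\<Sum>x\<in>F. w x) \<le> fact ?n + (\<Sum>(x, y)\<in>?P. real (pair_weight ?n x y))"
  proof -
    have "real (\<Sum>x\<in>F. chain_weight ?n x) \<le> real (fact ?n + (\<Sum>(x, y)\<in>?P. pair_weight ?n x y))"
      using LYM_with_pairs[OF U(1) FU] by (rule of_nat_mono)
    then show ?thesis by (simp add: w_def case_prod_unfold)
  qed
  also have "(\<Sum>(x, y)\<in>?P. real (pair_weight ?n x y)) \<le> (\<Sum>(x, y)\<in>?P. w x * b x y + w y * b x y)"
  proof (rule sum_mono)
    fix p assume p: "p \<in> ?P"
    then obtain x y where xy: "p = (x, y)" "x \<in> F" "y \<in> F" "x \<subset> y" by auto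
    have "real (pair_weight ?n x y) \<le> w x * b x y + w y * b x y"
      unfolding w_def b_def by (rule pair_weight_le[OF U(1) xy(4)]) (use xy F U in auto)
    then show "(case p of (x, y) \<Rightarrow> real (pair_weight ?n x y)) \<le> (case p of (x, y) \<Rightarrow> w x * b x y + w y * b x y)"
      by (simp add: xy(1))
  qed
  also have "\<dots> = (\<Sum>(x, y)\<in>?P. w x * b x y) + (\<Sum>(x, y)\<in>?P. w y * b x y)"
    by (simp add: case_prod_unfold sum.distrib)
  also have "(\<Sum>(x, y)\<in>?P. w x * b x y) = (\<Sum>x\<in>F. w x * (\<Sum>y\<in>{y\<in>F. x \<subset> y}. b x y))"
  proof -
    have "?P = (SIGMA x:F. {y\<in>F. x \<subset> y})" by auto
    then show ?thesis using finF by (simp add: sum.Sigma[symmetric] sum_distrib_left)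
  qed
  also have "\<dots> \<le> (\<Sum>x\<in>F. w x * \<kappa>)"
    by (intro sum_mono mult_left_mono sum_b up) (auto simp: w_def)
  also have "(\<Sum>(x, y)\<in>?P. w y * b x y) = (\<Sum>y\<in>F. w y * (\<Sum>x\<in>{x\<in>F. x \<subset> y}. b x y))"
  proof -
    have "?P = prod.swap ` (SIGMA y:F. {x\<in>F. x \<subset> y})" by force
    then have "(\<Sum>(x, y)\<in>?P. w y * b x y) = (\<Sum>(y, x)\<in>(SIGMA y:F. {x\<in>F. x \<subset> y}). w y * b x y)"
      by (simp add: sum.reindex case_prod_unfold)
    then show ?thesis using finF by (simp add: sum.Sigma[symmetric] sum_distrib_left)
  qed
  also have "\<dots> \<le> (\<Sum>y\<in>F. w y * \<kappa>)"
    by (intro sum_mono mult_left_mono sum_b down) (auto simp: w_def)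
  finally have main: "(1 - 2 * \<kappa>) * (\<Sum>x\<in>F. w x) \<le> fact ?n"
    unfolding sum_distrib_right[symmetric] by (simp add: algebra_simps)
  have "real (card F) * fact ?n = (\<Sum>x\<in>F. fact ?n)" by simp
  also have "\<dots> \<le> (\<Sum>x\<in>F. w x * real ?N)"
  proof (rule sum_mono)
    fix x assume "x \<in> F"
    then have "real (fact ?n) \<le> real (chain_weight ?n x * ?N)"
      using fact_le_chain_weight[OF U(1), of x] F by (intro of_nat_mono) blast
    then show "fact ?n \<le> w x * real ?N" by (simp add: w_def)
  qed
  also have "\<dots> = (\<Sum>x\<in>F. w x) * real ?N" by (simp add: sum_distrib_right)
  finally have "(1 - 2 * \<kappa>) * (real (card F) * fact ?n) \<le> (1 - 2 * \<kappa>) * ((\<Sum>x\<in>F. w x) * real ?N)"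
    using True by (rule mult_left_mono)
  also have "\<dots> \<le> fact ?n * real ?N"
    using mult_right_mono[OF main, of "real ?N"] by (simp add: mult_ac)
  finally have "(1 - 2 * \<kappa>) * real (card F) * fact ?n \<le> real ?N * fact ?n" by (simp add: mult_ac)
  then show ?thesis by (simp only: mult_le_cancel_right) (simp add: not_less)
qed

section \<open>Maximal antichains of low-degree families\<close>

definition comparable :: "'a set \<Rightarrow> 'a set \<Rightarrow> bool" where
  "comparable x y \<longleftrightarrow> x \<subset> y \<or> y \<subset> x"

interpretation cmp: graph_rel comparable
  by unfold_locales (auto simp: comparable_def)

text \<open>A maximal antichain of a low-degree family is counted at the cost of half a bit for each member of
  the short hull and one bit for each member of a long matching.\<close>

definition short_hull :: "nat \<Rightarrow> 'a set set \<Rightarrow> 'a set set" where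
  "short_hull T P = {x. \<exists>a\<in>P. \<exists>c\<in>P. a \<subseteq> x \<and> x \<subseteq> c \<and> card (c - a) \<le> T}"

text \<open>The last clause keeps different pairs apart. The ends of an isolated triangle satisfy it
  against all remaining members, and it makes the sets just above the lower ends an
  antichain.\<close>

definition long_matching :: "nat \<Rightarrow> 'a set set \<Rightarrow> ('a set \<times> 'a set) set \<Rightarrow> bool" where
  "long_matching T P S \<longleftrightarrow> S \<subseteq> P \<times> P \<and>
     (\<forall>p\<in>S. fst p \<subset> snd p \<and> T < card (snd p - fst p)) \<and>
     (\<forall>p\<in>S. \<forall>q\<in>S. fst p \<subseteq> snd q \<longrightarrow> p = q)"

lemma subset_hull: "P \<subseteq> short_hull T P"
  unfolding short_hull_def by fastforce

lemma hull_subset_Pow: "P \<subseteq> Pow U \<Longrightarrow> short_hull T P \<subseteq> Pow U"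
  unfolding short_hull_def by blast

text \<open>A set between two members that are incomparable to \<open>u\<close> is itself
  incomparable to \<open>u\<close>. A branch therefore removes the closed neighbourhood of
  \<open>u\<close> from the hull as well, and the hull can replace the family as the measure of
  progress.\<close>

lemma hull_Diff_cnbhd:
  assumes "u \<in> P"
  shows "short_hull T (P - cmp.cnbhd P u) \<subseteq> short_hull T P - cmp.cnbhd P u"
proof
  fix x assume "x \<in> short_hull T (P - cmp.cnbhd P u)"
  then obtain a c where ac: "a \<in> P - cmp.cnbhd P u" "c \<in> P - cmp.cnbhd P u"
    "a \<subseteq> x" "x \<subseteq> c" "card (c - a) \<le> T" unfolding short_hull_def by blast
  have "\<not> u \<subseteq> x" "\<not> x \<subseteq> u"
    using ac unfolding cmp.cnbhd_def comparable_def by blast+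
  then show "x \<in> short_hull T P - cmp.cnbhd P u"
    using ac unfolding short_hull_def cmp.cnbhd_def comparable_def by blast
qed

lemma long_matching_mono: "long_matching T P S \<Longrightarrow> P \<subseteq> Q \<Longrightarrow> long_matching T Q S"
  unfolding long_matching_def by blast

lemma card_long_matching_le:
  assumes "finite U" "P \<subseteq> Pow U" "long_matching T P S"
  shows "card S * (T + 1) \<le> card U choose (card U div 2)"
proof -
  \<comment> \<open>The sets \<open>insert i a\<close> with \<open>(a, c) \<in> S\<close> and \<open>i \<in> c - a\<close> are distinct and form an antichain.\<close>
  let ?D = "SIGMA p:S. snd p - fst p"
  define f :: "('a set \<times> 'a set) \<times> 'a \<Rightarrow> 'a set" where "f q = insert (snd q) (fst (fst q))" for q
  have SU: "S \<subseteq> Pow U \<times> Pow U" using assms unfolding long_matching_def by blast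
  have finS: "finite S" by (rule finite_subset[OF SU]) (use assms in simp)
  have S: "a \<subset> c" "T < card (c - a)" "finite (c - a)" "c \<subseteq> U" if "(a, c) \<in> S" for a c
    using assms SU that unfolding long_matching_def by (fastforce intro: finite_subset)+
  have S': "(a, c) = (a', c')" if "(a, c) \<in> S" "(a', c') \<in> S" "a \<subseteq> c'" for a c a' c'
    using assms(3) that unfolding long_matching_def by fastforce
  have eq: "p = q" if "p \<in> ?D" "q \<in> ?D" "f p \<subseteq> f q" for p q
  proof -
    obtain a c i where p: "p = ((a, c), i)" "(a, c) \<in> S" "i \<in> c - a" using \<open>p \<in> ?D\<close> by force
    obtain a' c' j where q: "q = ((a', c'), j)" "(a', c') \<in> S" "j \<in> c' - a'" using \<open>q \<in> ?D\<close> by force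
    have "insert i a \<subseteq> insert j a'" using that(3) p q by (simp add: f_def)
    moreover have "a' \<subseteq> c'" using S(1)[OF q(2)] by blast
    ultimately have "a \<subseteq> c'" using q by blast
    then have e: "(a, c) = (a', c')" by (rule S'[OF p(2) q(2)])
    then have "i = j" using \<open>insert i a \<subseteq> insert j a'\<close> p(3) q(3) by blast
    then show ?thesis using e p q by simp
  qed
  have "inj_on f ?D" using eq by (intro inj_onI) blast
  then have "card (f ` ?D) = card ?D" by (rule card_image)
  moreover have "card (f ` ?D) \<le> card U choose (card U div 2)"
  proof (rule Sperner[OF assms(1)])
    show "f ` ?D \<subseteq> Pow U" using S unfolding f_def by fastforce
    fix x y assume "x \<in> f ` ?D" "y \<in> f ` ?D"
    then show "\<not> x \<subset> y" using eq by blast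
  qed
  moreover have "card ?D = (\<Sum>p\<in>S. card (snd p - fst p))"
    by (rule card_SigmaI[OF finS]) (use S in force)
  moreover have "(\<Sum>p\<in>S. T + 1) \<le> (\<Sum>p\<in>S. card (snd p - fst p))"
    by (rule sum_mono) (use S in force)
  ultimately show ?thesis by simp
qed

text \<open>The cost of branching at a vertex of degree \<open>m - 1\<close> whose neighbours have
  no smaller degree. Equality holds at \<open>m = 4\<close>; at \<open>m = 3\<close> the product is
  about 1.06, which is why the 2-regular case needs separate treatment.\<close>

lemma mult_power_inverse_sqrt2_le_1:
  assumes "4 \<le> m"
  shows "real m * (1 / sqrt 2) ^ m \<le> 1"
  using assms
proof (induction m rule: dec_induct)
  case base
  have "(1 / sqrt 2) ^ 4 = (1 / 4 :: real)"
    by (simp add: power_divide power4_eq_xxxx)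
  then show ?case by simp
next
  case (step m)
  have z: "1 / sqrt 2 \<le> 3 / 4"
    using real_le_lsqrt[of "4/3" 2] real_le_rsqrt[of "4/3" 2] by (simp add: field_simps power2_eq_square)
  have "real (Suc m) * (1 / sqrt 2) \<le> real (Suc m) * (3 / 4)"
    using z by (rule mult_left_mono) simp
  also have "\<dots> \<le> real m" using step by simp
  finally have "real (Suc m) * (1 / sqrt 2) * (1 / sqrt 2) ^ m \<le> real m * (1 / sqrt 2) ^ m"
    by (rule mult_right_mono) simp
  also have "\<dots> \<le> 1" by (rule step.IH)
  finally show ?case by (simp add: mult_ac)
qed

text \<open>Induction with the potential \<open>card (short_hull T P) / 2 + t\<close> in bits.
  Branching at \<open>v\<close> succeeds when the weights \<open>z ^ Suc (deg u)\<close> over its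
  closed neighbourhood sum to at most 1; failure at every vertex forces 2-regularity. The bound
  \<open>t\<close> varies in the induction because removing a long triangle lowers it by
  one.\<close>

lemma num_le_hull:
  assumes "finite U" "P \<subseteq> Pow U" "\<And>S. long_matching T P S \<Longrightarrow> card S \<le> t"
  shows "real (cmp.num P) \<le> sqrt 2 ^ card (short_hull T P) * 2 ^ t"
proof -
  have "finite P" using assms by (meson finite_Pow_iff finite_subset)
  then show ?thesis using assms(2,3)
  proof (induction P arbitrary: t rule: finite_psubset_induct)
    case (psubset P)
    note fin = psubset.hyps and PU = psubset.prems(1)
    define h where "h = card (short_hull T P)"
    define deg where "deg u = card (cmp.nbhd P u)" for u
    define z :: real where "z = 1 / sqrt 2"
    have z: "z > 0" "z \<le> 3 / 4" "z * z = 1 / 2" "z * sqrt 2 = 1"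
      using real_le_rsqrt[of "4/3" 2] unfolding z_def by (auto simp: field_simps power2_eq_square)
    have z3: "z ^ 3 = z / 2"
    proof -
      have "z ^ 3 = (z * z) * z" by (simp add: power3_eq_cube)
      then show ?thesis unfolding z(3) by simp
    qed
    have z4: "z ^ 4 = 1 / 4"
    proof -
      have "z ^ 4 = (z * z) * (z * z)" by (simp add: power4_eq_xxxx)
      then show ?thesis unfolding z(3) by simp
    qed
    have finH: "finite (short_hull T Q)" if "Q \<subseteq> P" for Q
      using hull_subset_Pow[of Q U T] that PU assms(1) by (meson finite_Pow_iff finite_subset order_trans)
    have zs: "sqrt 2 ^ m = z ^ k * sqrt 2 ^ (m + k)" for m k
    proof -
      have "z ^ k * sqrt 2 ^ k = 1" using z by (simp flip: power_mult_distrib)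
      then show ?thesis by (simp add: power_add mult_ac)
    qed
    have branch: "real (cmp.num (P - cmp.cnbhd P u)) \<le> z ^ k * (sqrt 2 ^ h * 2 ^ t')"
      if u: "u \<in> P" and k: "card (short_hull T (P - cmp.cnbhd P u)) + k \<le> h"
        and t': "\<And>S. long_matching T (P - cmp.cnbhd P u) S \<Longrightarrow> card S \<le> t'" for u k t'
    proof -
      have "u \<in> cmp.cnbhd P u" using u by (simp add: cmp.cnbhd_def)
      then have "P - cmp.cnbhd P u \<subset> P" using u by blast
      then have "real (cmp.num (P - cmp.cnbhd P u)) \<le> sqrt 2 ^ card (short_hull T (P - cmp.cnbhd P u)) * 2 ^ t'"
        using psubset.IH[of "P - cmp.cnbhd P u" t'] PU t' by blast
      also have "\<dots> = z ^ k * (sqrt 2 ^ (card (short_hull T (P - cmp.cnbhd P u)) + k) * 2 ^ t')"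
        using zs[of "card (short_hull T (P - cmp.cnbhd P u))" k] by simp
      also have "\<dots> \<le> z ^ k * (sqrt 2 ^ h * 2 ^ t')"
        using k z by (intro mult_left_mono mult_right_mono power_increasing) auto
      finally show ?thesis .
    qed
    have branch_deg: "real (cmp.num (P - cmp.cnbhd P u)) \<le> z ^ Suc (deg u) * (sqrt 2 ^ h * 2 ^ t)"
      if u: "u \<in> P" for u
    proof (rule branch[OF u])
      have "card (short_hull T (P - cmp.cnbhd P u)) \<le> card (short_hull T P - cmp.cnbhd P u)"
        by (rule card_mono) (use finH hull_Diff_cnbhd[OF u] in auto)
      moreover have sub: "cmp.cnbhd P u \<subseteq> short_hull T P" using subset_hull[of P T] by (auto simp: cmp.cnbhd_def)
      moreover have "card (cmp.cnbhd P u) = Suc (deg u)"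
        using cmp.card_cnbhd[OF fin u] by (simp add: deg_def)
      moreover have "card (cmp.cnbhd P u) \<le> card (short_hull T P)"
        using sub by (rule card_mono[rotated]) (simp add: finH)
      ultimately show "card (short_hull T (P - cmp.cnbhd P u)) + Suc (deg u) \<le> h"
        using fin by (simp add: h_def card_Diff_subset)
      show "card S \<le> t" if "long_matching T (P - cmp.cnbhd P u) S" for S
        using psubset.prems(2) long_matching_mono[OF that] by blast
    qed
    show "real (cmp.num P) \<le> sqrt 2 ^ card (short_hull T P) * 2 ^ t"
    proof (cases "\<exists>v\<in>P. (\<Sum>u\<in>cmp.cnbhd P v. z ^ Suc (deg u)) \<le> 1")
      case True
      then obtain v where v: "v \<in> P" "(\<Sum>u\<in>cmp.cnbhd P v. z ^ Suc (deg u)) \<le> 1" by blast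
      have "real (cmp.num P) \<le> (\<Sum>u\<in>cmp.cnbhd P v. real (cmp.num (P - cmp.cnbhd P u)))"
        using cmp.num_branch_nbhd[OF fin v(1)] by (metis of_nat_le_iff of_nat_sum)
      also have "\<dots> \<le> (\<Sum>u\<in>cmp.cnbhd P v. z ^ Suc (deg u) * (sqrt 2 ^ h * 2 ^ t))"
        by (intro sum_mono branch_deg) (auto simp: cmp.cnbhd_def)
      also have "\<dots> = (\<Sum>u\<in>cmp.cnbhd P v. z ^ Suc (deg u)) * (sqrt 2 ^ h * 2 ^ t)"
        by (simp only: sum_distrib_right)
      also have "\<dots> \<le> 1 * (sqrt 2 ^ h * 2 ^ t)"
        using v(2) by (intro mult_right_mono) auto
      finally show ?thesis by (simp add: h_def)
    next
      case False
      then have bad: "(\<Sum>u\<in>cmp.cnbhd P v. z ^ Suc (deg u)) > 1" if "v \<in> P" for v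
        using that by force
      have card_c: "card (cmp.cnbhd P v) = Suc (deg v)" if "v \<in> P" for v
        using cmp.card_cnbhd[OF fin that] by (simp add: deg_def)
      have sum_le: "(\<Sum>u\<in>cmp.cnbhd P v. z ^ Suc (deg u)) \<le> real (Suc (deg v)) * z ^ Suc k"
        if "v \<in> P" "\<And>u. u \<in> cmp.cnbhd P v \<Longrightarrow> k \<le> deg u" for v k
      proof -
        have "(\<Sum>u\<in>cmp.cnbhd P v. z ^ Suc (deg u)) \<le> (\<Sum>u\<in>cmp.cnbhd P v. z ^ Suc k)"
          using that(2) z by (intro sum_mono power_decreasing) auto
        then show ?thesis using card_c[OF that(1)] by simp
      qed
      have deg_pos: "1 \<le> deg u" if "u \<in> P" "v \<in> P" "comparable v u" for u v
      proof -
        have "v \<in> cmp.nbhd P u" using that cmp.sym by (simp add: cmp.nbhd_def)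
        then show ?thesis using fin unfolding deg_def
          by (metis One_nat_def Suc_leI card_gt_0_iff cmp.finite_nbhd empty_iff)
      qed
      \<comment> \<open>An isolated vertex gives the sum \<open>z\<close>, a vertex of degree 1 at
        most \<open>2 * z ^ 2 = 1\<close>.\<close>
      have deg_ge2: "2 \<le> deg v" if v: "v \<in> P" for v
      proof (rule ccontr)
        assume "\<not> 2 \<le> deg v"
        then consider "deg v = 0" | "deg v = 1" by linarith
        then show False
        proof cases
          case 1
          then show False using sum_le[OF v, of 0] bad[OF v] z by simp
        next
          case 2
          have "(\<Sum>u\<in>cmp.cnbhd P v. z ^ Suc (deg u)) \<le> real (Suc (deg v)) * z ^ Suc 1"
            by (rule sum_le[OF v]) (use 2 deg_pos v in \<open>auto simp: cmp.cnbhd_def\<close>)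
          then show False using bad[OF v] z 2 by simp
        qed
      qed
      \<comment> \<open>A neighbour of degree at least 3 would bring the sum down to
        \<open>z ^ 4 + 2 * z ^ 3 = 1 / 4 + z\<close>, which is at most 1.\<close>
      have deg2_nbhd: "deg u = 2" if v: "v \<in> P" "deg v = 2" and u: "u \<in> P" "comparable v u" for u v
      proof (rule ccontr)
        assume "deg u \<noteq> 2"
        then have u3: "3 \<le> deg u" using deg_ge2[OF u(1)] by simp
        have uin: "u \<in> cmp.cnbhd P v" using u by (simp add: cmp.cnbhd_def)
        have "(\<Sum>w\<in>cmp.cnbhd P v. z ^ Suc (deg w)) =
            z ^ Suc (deg u) + (\<Sum>w\<in>cmp.cnbhd P v - {u}. z ^ Suc (deg w))"
          using uin fin by (simp add: sum.remove)
        also have "z ^ Suc (deg u) \<le> z ^ 4"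
          using u3 z by (intro power_decreasing) auto
        also have "(\<Sum>w\<in>cmp.cnbhd P v - {u}. z ^ Suc (deg w)) \<le> (\<Sum>w\<in>cmp.cnbhd P v - {u}. z ^ 3)"
          using z deg_ge2 by (intro sum_mono power_decreasing) (auto simp: cmp.cnbhd_def eval_nat_numeral)
        also have "\<dots> = 2 * z ^ 3" using uin fin card_c[OF v(1)] v(2) by simp
        also have "z ^ 4 + 2 * z ^ 3 = 1 / 4 + z"
          by (simp add: z3 z4)
        finally show False using bad[OF v(1)] z by simp
      qed
      \<comment> \<open>Take a vertex of least degree among those of degree at least 3. By
        \<open>deg2_nbhd\<close> it has no neighbour of degree 2, so no neighbour has smaller degree
        and \<open>mult_power_inverse_sqrt2_le_1\<close> applies.\<close>
      have deg2: "deg v = 2" if "v \<in> P" for v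
      proof (rule ccontr)
        assume "deg v \<noteq> 2"
        then have "v \<in> P \<and> 3 \<le> deg v" using deg_ge2[OF that] that by simp
        then obtain w where w: "w \<in> P" "3 \<le> deg w" "\<And>u. u \<in> P \<Longrightarrow> 3 \<le> deg u \<Longrightarrow> deg w \<le> deg u"
          using ex_has_least_nat[of "\<lambda>v. v \<in> P \<and> 3 \<le> deg v" v deg] by blast
        have "(\<Sum>u\<in>cmp.cnbhd P w. z ^ Suc (deg u)) \<le> real (Suc (deg w)) * z ^ Suc (deg w)"
        proof (rule sum_le[OF w(1)])
          fix u assume u: "u \<in> cmp.cnbhd P w"
          show "deg w \<le> deg u"
          proof (cases "u = w")
            case False
            then have uw: "u \<in> P" "comparable u w" using u cmp.sym by (auto simp: cmp.cnbhd_def)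
            then have "deg u \<noteq> 2" using deg2_nbhd[of u w] w by auto
            then show ?thesis using w(3)[of u] deg_ge2[OF uw(1)] uw by simp
          qed simp
        qed
        also have "\<dots> \<le> 1"
          unfolding z_def by (rule mult_power_inverse_sqrt2_le_1) (use w in simp)
        finally show False using bad[OF w(1)] by simp
      qed
      \<comment> \<open>Every component is now a cycle; without a 3-chain the graph is bipartite, with one it
        contains a triangle component.\<close>
      show ?thesis
      proof (cases "\<exists>a\<in>P. \<exists>b\<in>P. \<exists>c\<in>P. a \<subset> b \<and> b \<subset> c")
        case no_chain: False
        \<comment> \<open>Without a 3-chain both \<open>X\<close> and its complement, the minimal
          members, are antichains; the trace on the smaller one determines a maximal
          antichain.\<close>
        define X where "X = {x\<in>P. \<exists>y\<in>P. y \<subset> x}"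
        have "X \<subseteq> P" by (auto simp: X_def)
        then have c: "card X + card (P - X) = card P"
          using fin card_mono[of P X] by (simp add: card_Diff_subset finite_subset)
        have "real (cmp.num P) \<le> sqrt 2 ^ card P"
        proof (cases "card X \<le> card (P - X)")
          case True
          have "cmp.num P \<le> 2 ^ card X"
            by (rule cmp.num_le_two_power_card[OF fin]) (auto simp: X_def comparable_def)
          then have "real (cmp.num P) \<le> 2 ^ card X" by (metis of_nat_le_iff of_nat_numeral of_nat_power)
          also have "(2 :: real) ^ card X = sqrt 2 ^ (2 * card X)" by (simp add: power_mult)
          also have "\<dots> \<le> sqrt 2 ^ card P" using True c by (intro power_increasing) auto
          finally show ?thesis .
        next
          case False
          have "cmp.num P \<le> 2 ^ card (P - X)"
            by (rule cmp.num_le_two_power_card[OF fin])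
              (use no_chain in \<open>auto simp: X_def comparable_def\<close>)
          then have "real (cmp.num P) \<le> 2 ^ card (P - X)" by (metis of_nat_le_iff of_nat_numeral of_nat_power)
          also have "(2 :: real) ^ card (P - X) = sqrt 2 ^ (2 * card (P - X))" by (simp add: power_mult)
          also have "\<dots> \<le> sqrt 2 ^ card P" using False c by (intro power_increasing) auto
          finally show ?thesis .
        qed
        also have "\<dots> \<le> sqrt 2 ^ h * 1"
          using card_mono[OF finH[OF subset_refl] subset_hull[of P T]]
          by (simp add: h_def power_increasing)
        also have "\<dots> \<le> sqrt 2 ^ h * 2 ^ t" by (intro mult_left_mono) auto
        finally show ?thesis by (simp add: h_def)
      next
        case True
        then obtain a b c where abc: "a \<in> P" "b \<in> P" "c \<in> P" "a \<subset> b" "b \<subset> c" by blast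
        let ?A = "{a, b, c}"
        have ne: "a \<noteq> b" "b \<noteq> c" "a \<noteq> c" using abc by blast+
        then have card_A: "card ?A = 3" by simp
        \<comment> \<open>By 2-regularity the triangle is a whole component, so branching at
          \<open>a\<close> leaves the same rest three times.\<close>
        have N: "cmp.cnbhd P u = ?A" if "u \<in> ?A" for u
        proof -
          have "?A \<subseteq> cmp.cnbhd P u" using that abc by (auto simp: cmp.cnbhd_def comparable_def)
          moreover have "card (cmp.cnbhd P u) = card ?A"
            using card_c[of u] deg2[of u] that abc unfolding card_A by auto
          ultimately show ?thesis
            using fin by (metis card_subset_eq cmp.finite_cnbhd)
        qed
        have "real (cmp.num P) \<le> (\<Sum>u\<in>cmp.cnbhd P a. real (cmp.num (P - cmp.cnbhd P u)))"
          using cmp.num_branch_nbhd[OF fin abc(1)] by (metis of_nat_le_iff of_nat_sum)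
        also have "\<dots> = (\<Sum>u\<in>?A. real (cmp.num (P - ?A)))"
          using N by (intro sum.cong) auto
        also have "\<dots> = 3 * real (cmp.num (P - ?A))" by (simp add: card_A)
        finally have three: "real (cmp.num P) \<le> 3 * real (cmp.num (P - ?A))" .
        have far: "\<not> x \<subseteq> c \<and> \<not> a \<subseteq> x" if "x \<in> P - ?A" for x
          using N[of a] N[of c] that abc unfolding cmp.cnbhd_def comparable_def by blast
        have sub_H: "short_hull T (P - ?A) \<subseteq> short_hull T P - ?A" "?A \<subseteq> short_hull T P"
          using hull_Diff_cnbhd[OF abc(1), of T] N[of a] subset_hull[of P T] abc by auto
        show ?thesis
        proof (cases "card (c - a) \<le> T")
          case True
          \<comment> \<open>The complement of \<open>b\<close> in the interval from \<open>a\<close>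
            to \<open>c\<close>. It leaves the hull together with the triangle, because no remaining
            member lies below \<open>c\<close>. Four lost elements turn the three branches into the
            factor \<open>3 / 4\<close>.\<close>
          define b' where "b' = a \<union> (c - b)"
          have b': "a \<subset> b'" "b' \<subset> c" "b \<noteq> b'" "c \<noteq> b'" using abc unfolding b'_def by blast+
          have "b' \<in> short_hull T P" using abc True b' unfolding short_hull_def by blast
          moreover have "b' \<notin> short_hull T (P - ?A)"
          proof
            assume "b' \<in> short_hull T (P - ?A)"
            then obtain a1 where "a1 \<in> P - ?A" "a1 \<subseteq> b'" unfolding short_hull_def by blast
            then show False using far[of a1] b' by blast
          qed
          ultimately have "short_hull T (P - ?A) \<subseteq> short_hull T P - {a, b, c, b'}" "{a, b, c, b'} \<subseteq> short_hull T P"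
            using sub_H by blast+
          moreover have "card {a, b, c, b'} = 4" using ne b' by (simp add: psubset_eq)
          ultimately have "card (short_hull T (P - ?A)) + 4 \<le> h"
            using card_mono[of "short_hull T P - {a, b, c, b'}" "short_hull T (P - ?A)"] finH[OF subset_refl]
              card_mono[of "short_hull T P" "{a, b, c, b'}"]
            by (simp add: h_def card_Diff_subset)
          then have "real (cmp.num (P - ?A)) \<le> z ^ 4 * (sqrt 2 ^ h * 2 ^ t)"
            using branch[OF abc(1), of 4 t] psubset.prems(2) long_matching_mono[of T "P - ?A" _ P] N[of a]
            by auto
          also have "z ^ 4 = 1 / 4" by (rule z4)
          finally have "3 * real (cmp.num (P - ?A)) \<le> 3 / 4 * (sqrt 2 ^ h * 2 ^ t)"
            by (simp add: mult_ac)
          also have "\<dots> \<le> 1 * (sqrt 2 ^ h * 2 ^ t)" by (intro mult_right_mono) auto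
          finally show ?thesis using three by (simp add: h_def)
        next
          case False
          \<comment> \<open>The pair \<open>(a, c)\<close> extends every long matching of the rest,
            so the rest allows one pair fewer. The saved bit pays for the triangle:
            \<open>3 * z ^ 3 / 2 = 3 / 4 * z\<close>.\<close>
          have bound: "Suc (card S) \<le> t" if S: "long_matching T (P - ?A) S" for S
          proof -
            have "S \<subseteq> P \<times> P" using S unfolding long_matching_def by blast
            then have "finite S" using fin by (meson finite_SigmaI finite_subset)
            have "(a, c) \<notin> S" using S unfolding long_matching_def by blast
            have far': "\<not> fst p \<subseteq> c \<and> \<not> a \<subseteq> snd p" if "p \<in> S" for p
            proof -
              have "fst p \<in> P - ?A" "snd p \<in> P - ?A"
                using S that unfolding long_matching_def by (auto simp: mem_Times_iff)
              then show ?thesis using far by blast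
            qed
            have "long_matching T P (insert (a, c) S)"
              unfolding long_matching_def
            proof (intro conjI ballI impI)
              show "insert (a, c) S \<subseteq> P \<times> P" using \<open>S \<subseteq> P \<times> P\<close> abc by simp
              show "fst p \<subset> snd p" "T < card (snd p - fst p)" if "p \<in> insert (a, c) S" for p
                using that S psubset_trans[OF abc(4,5)] False unfolding long_matching_def by auto
              show "p = q" if "p \<in> insert (a, c) S" "q \<in> insert (a, c) S" "fst p \<subseteq> snd q" for p q
                using that S far' unfolding long_matching_def by auto
            qed
            then show ?thesis
              using psubset.prems(2) \<open>finite S\<close> \<open>(a, c) \<notin> S\<close> by force
          qed
          have "long_matching T (P - ?A) {}" by (simp add: long_matching_def)
          then have "t \<ge> 1" using bound by force
          then obtain s where s: "t = Suc s" by (cases t) auto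
          have "card (short_hull T (P - ?A)) + 3 \<le> h"
            using card_mono[of "short_hull T P - ?A" "short_hull T (P - ?A)"] finH[OF subset_refl]
              card_mono[of "short_hull T P" ?A] card_A sub_H
            by (simp add: h_def card_Diff_subset)
          then have "real (cmp.num (P - ?A)) \<le> z ^ 3 * (sqrt 2 ^ h * 2 ^ s)"
            using branch[OF abc(1), of 3 s] bound N[of a] s by auto
          also have "z ^ 3 = z / 2" by (rule z3)
          finally have "3 * real (cmp.num (P - ?A)) \<le> (3 / 4 * z) * (sqrt 2 ^ h * 2 ^ t)"
            by (simp add: s mult_ac)
          also have "\<dots> \<le> 1 * (sqrt 2 ^ h * 2 ^ t)" using z by (intro mult_right_mono) auto
          finally show ?thesis using three by (simp add: h_def)
        qed
      qed
    qed
  qed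
qed

section \<open>Degrees and size of the short hull\<close>

lemma card_UN_le_mult:
  assumes "finite I" "card I \<le> d" "\<And>i. i \<in> I \<Longrightarrow> card (A i) \<le> m"
  shows "card (\<Union>i\<in>I. A i) \<le> d * m"
proof -
  have "card (\<Union>i\<in>I. A i) \<le> (\<Sum>i\<in>I. card (A i))" by (rule card_UN_le[OF assms(1)])
  also have "\<dots> \<le> (\<Sum>i\<in>I. m)" by (rule sum_mono) (rule assms(3))
  also have "\<dots> \<le> d * m" using assms(2) by simp
  finally show ?thesis .
qed

lemma card_interval_le:
  assumes "finite c" "card (c - a) \<le> T"
  shows "card {y. a \<subseteq> y \<and> y \<subseteq> c} \<le> 2 ^ T"
proof -
  have "{y. a \<subseteq> y \<and> y \<subseteq> c} \<subseteq> (\<union>) a ` Pow (c - a)"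
  proof
    fix y assume "y \<in> {y. a \<subseteq> y \<and> y \<subseteq> c}"
    then have "y = a \<union> (y - a)" "y - a \<in> Pow (c - a)" by blast+
    then show "y \<in> (\<union>) a ` Pow (c - a)" by (rule image_eqI)
  qed
  then have "card {y. a \<subseteq> y \<and> y \<subseteq> c} \<le> card ((\<union>) a ` Pow (c - a))"
    by (rule card_mono[rotated]) (simp add: assms)
  also have "\<dots> \<le> card (Pow (c - a))" by (rule card_image_le) (simp add: assms)
  also have "\<dots> = 2 ^ card (c - a)" by (simp add: card_Pow assms)
  also have "\<dots> \<le> 2 ^ T" using assms(2) by (rule power_increasing) simp
  finally show ?thesis .
qed

lemma card_cover_Diff:
  assumes "finite y" "x \<subset> y" "card y = card x + 1"
  shows "card (y - x) = 1"
proof -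
  have "finite x" using assms finite_subset by blast
  then show ?thesis using assms by (simp add: card_Diff_subset psubset_eq)
qed

lemma card_Diff_cover_le:
  assumes "finite y" "x \<subset> y" "card y = card x + 1"
  shows "finite c \<Longrightarrow> card (c - x) \<le> card (c - y) + 1" "card (y - b) \<le> card (x - b) + 1"
proof -
  have fx: "finite x" using assms finite_subset by blast
  have one: "card (y - x) = 1" using assms by (rule card_cover_Diff)
  show "card (c - x) \<le> card (c - y) + 1" if "finite c"
  proof -
    have "card (c - x) \<le> card ((c - y) \<union> (y - x))"
      by (rule card_mono) (use that assms in auto)
    then show ?thesis using card_Un_le[of "c - y" "y - x"] one by linarith
  qed
  have "card (y - b) \<le> card ((x - b) \<union> (y - x))"
    by (rule card_mono) (use fx assms in auto)
  then show "card (y - b) \<le> card (x - b) + 1" using card_Un_le[of "x - b" "y - x"] one by linarith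
qed

context
  fixes U :: "'a set" and P :: "'a set set" and d T :: nat
  assumes finU: "finite U" and PU: "P \<subseteq> Pow U"
    and deg: "\<And>v. v \<in> P \<Longrightarrow> card (cmp.nbhd P v) \<le> d"
begin

lemma finite_family: "finite P"
  using finU PU by (meson finite_Pow_iff finite_subset)

lemma finite_member: "x \<in> P \<Longrightarrow> finite x"
  using finU PU by (meson PowD finite_subset subsetD)

lemma finite_hull_member: "x \<in> short_hull T P \<Longrightarrow> finite x"
  unfolding short_hull_def using finite_member finite_subset by blast

lemma card_closed_nbhd_le: "v \<in> P \<Longrightarrow> card (cmp.cnbhd P v) \<le> d + 1"
  using deg cmp.card_cnbhd[OF finite_family] by simp

text \<open>Some member \<open>a\<close> lies below \<open>x\<close>, and a hull set
  \<open>y\<close> above \<open>x\<close> lies below a member \<open>c\<close>, one of at most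
  \<open>d\<close> neighbours of \<open>a\<close>. The lower end of the interval holding
  \<open>y\<close> is in the closed neighbourhood of \<open>c\<close>, and that interval has at most
  \<open>2 ^ T\<close> elements.\<close>

lemma hull_up_degree:
  assumes "x \<in> short_hull T P"
  shows "card {y \<in> short_hull T P. x \<subset> y} \<le> d * ((d + 1) * 2 ^ T)"
proof -
  obtain a where a: "a \<in> P" "a \<subseteq> x" using assms unfolding short_hull_def by blast
  define I where "I c = {b \<in> cmp.cnbhd P c. card (c - b) \<le> T}" for c
  let ?B = "\<Union>c\<in>cmp.nbhd P a. \<Union>b\<in>I c. {y. b \<subseteq> y \<and> y \<subseteq> c}"
  have finI: "finite (I c)" for c by (simp add: I_def finite_family)
  have "{y \<in> short_hull T P. x \<subset> y} \<subseteq> ?B"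
  proof
    fix y assume "y \<in> {y \<in> short_hull T P. x \<subset> y}"
    then obtain b c where bc: "x \<subset> y" "b \<in> P" "c \<in> P" "b \<subseteq> y" "y \<subseteq> c" "card (c - b) \<le> T"
      unfolding short_hull_def by blast
    then have "c \<in> cmp.nbhd P a" using a unfolding cmp.nbhd_def comparable_def by blast
    moreover have "b \<in> I c" using bc unfolding I_def cmp.cnbhd_def comparable_def by blast
    ultimately show "y \<in> ?B" using bc by blast
  qed
  moreover have "finite ?B"
    by (rule finite_subset[of _ "Pow U"]) (use PU finU in \<open>fastforce simp: cmp.nbhd_def\<close>)+
  ultimately have "card {y \<in> short_hull T P. x \<subset> y} \<le> card ?B" by (rule card_mono[rotated])
  also have "\<dots> \<le> d * ((d + 1) * 2 ^ T)"
  proof (intro card_UN_le_mult)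
    fix c assume "c \<in> cmp.nbhd P a"
    then have c: "c \<in> P" by (simp add: cmp.nbhd_def)
    have "card (I c) \<le> card (cmp.cnbhd P c)" unfolding I_def
      by (rule card_mono) (auto simp: finite_family)
    then show "card (I c) \<le> d + 1" using card_closed_nbhd_le[OF c] by simp
    show "card {y. b \<subseteq> y \<and> y \<subseteq> c} \<le> 2 ^ T" if "b \<in> I c" for b
      using that finite_member[OF c] by (intro card_interval_le) (auto simp: I_def)
  qed (use finI finite_family deg[OF a(1)] in auto)
  finally show ?thesis .
qed

lemma hull_down_degree:
  assumes "x \<in> short_hull T P"
  shows "card {y \<in> short_hull T P. y \<subset> x} \<le> d * ((d + 1) * 2 ^ T)"
proof -
  obtain c where c: "c \<in> P" "x \<subseteq> c" using assms unfolding short_hull_def by blast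
  define I where "I b = {e \<in> cmp.cnbhd P b. card (e - b) \<le> T}" for b
  let ?B = "\<Union>b\<in>cmp.nbhd P c. \<Union>e\<in>I b. {y. b \<subseteq> y \<and> y \<subseteq> e}"
  have finI: "finite (I b)" for b by (simp add: I_def finite_family)
  have "{y \<in> short_hull T P. y \<subset> x} \<subseteq> ?B"
  proof
    fix y assume "y \<in> {y \<in> short_hull T P. y \<subset> x}"
    then obtain b e where be: "y \<subset> x" "b \<in> P" "e \<in> P" "b \<subseteq> y" "y \<subseteq> e" "card (e - b) \<le> T"
      unfolding short_hull_def by blast
    then have "b \<in> cmp.nbhd P c" using c unfolding cmp.nbhd_def comparable_def by blast
    moreover have "e \<in> I b" using be unfolding I_def cmp.cnbhd_def comparable_def by blast
    ultimately show "y \<in> ?B" using be by blast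
  qed
  moreover have "finite ?B"
    by (rule finite_subset[of _ "Pow U"]) (use PU finU in \<open>fastforce simp: I_def cmp.cnbhd_def\<close>)+
  ultimately have "card {y \<in> short_hull T P. y \<subset> x} \<le> card ?B" by (rule card_mono[rotated])
  also have "\<dots> \<le> d * ((d + 1) * 2 ^ T)"
  proof (intro card_UN_le_mult)
    fix b assume "b \<in> cmp.nbhd P c"
    then have b: "b \<in> P" by (simp add: cmp.nbhd_def)
    have "card (I b) \<le> card (cmp.cnbhd P b)" unfolding I_def
      by (rule card_mono) (auto simp: finite_family)
    then show "card (I b) \<le> d + 1" using card_closed_nbhd_le[OF b] by simp
    show "card {y. b \<subseteq> y \<and> y \<subseteq> e} \<le> 2 ^ T" if "e \<in> I b" for e
      using that finite_member by (intro card_interval_le) (auto simp: I_def cmp.cnbhd_def)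
  qed (use finI finite_family deg[OF c(1)] in auto)
  finally show ?thesis .
qed

text \<open>A cover of \<open>x\<close> arises by adding an element of \<open>c - x\<close>, which
  has at most \<open>T + 1\<close> elements, so only the upper end \<open>c\<close> has to be
  chosen. This keeps the bound linear in \<open>d\<close>, as pairs of relative weight O(1/n)
  require.\<close>

lemma hull_up_cover_degree:
  assumes "x \<in> short_hull T P"
  shows "card {y \<in> short_hull T P. x \<subset> y \<and> card y = card x + 1} \<le> d * (T + 1)"
proof -
  obtain a where a: "a \<in> P" "a \<subseteq> x" using assms unfolding short_hull_def by blast
  let ?I = "{c \<in> cmp.nbhd P a. card (c - x) \<le> T + 1}"
  let ?B = "\<Union>c\<in>?I. (\<lambda>i. insert i x) ` (c - x)"
  have "{y \<in> short_hull T P. x \<subset> y \<and> card y = card x + 1} \<subseteq> ?B"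
  proof
    fix y assume y: "y \<in> {y \<in> short_hull T P. x \<subset> y \<and> card y = card x + 1}"
    then obtain b c where bc: "x \<subset> y" "card y = card x + 1" "b \<in> P" "c \<in> P" "b \<subseteq> y" "y \<subseteq> c" "card (c - b) \<le> T"
      unfolding short_hull_def by blast
    have fy: "finite y" using y finite_hull_member by blast
    have "card (c - y) \<le> card (c - b)"
      using bc finite_member[OF bc(4)] by (intro card_mono) auto
    then have "card (c - x) \<le> T + 1"
      using card_Diff_cover_le(1)[OF fy bc(1,2) finite_member[OF bc(4)]] bc by linarith
    moreover have "c \<in> cmp.nbhd P a" using a bc unfolding cmp.nbhd_def comparable_def by blast
    moreover have "\<exists>i. i \<in> c - x \<and> y = insert i x"
    proof -
      have "card (y - x) = 1" by (rule card_cover_Diff[OF fy bc(1,2)])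
      then obtain i where "y - x = {i}" by (rule card_1_singletonE)
      then show ?thesis using bc by blast
    qed
    ultimately show "y \<in> ?B" by blast
  qed
  moreover have "finite ?B"
    using finite_member finite_family by (auto simp: cmp.nbhd_def)
  ultimately have "card {y \<in> short_hull T P. x \<subset> y \<and> card y = card x + 1} \<le> card ?B" by (rule card_mono[rotated])
  also have "\<dots> \<le> d * (T + 1)"
  proof (rule card_UN_le_mult)
    have "card ?I \<le> card (cmp.nbhd P a)" by (rule card_mono) (auto simp: finite_family)
    then show "card ?I \<le> d" using deg[OF a(1)] by simp
    fix c assume c: "c \<in> ?I"
    have "card ((\<lambda>i. insert i x) ` (c - x)) \<le> card (c - x)"
      by (rule card_image_le) (use c finite_member in \<open>auto simp: cmp.nbhd_def\<close>)
    then show "card ((\<lambda>i. insert i x) ` (c - x)) \<le> T + 1" using c by simp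
  qed (simp add: finite_family)
  finally show ?thesis .
qed

lemma hull_down_cover_degree:
  assumes "x \<in> short_hull T P"
  shows "card {y \<in> short_hull T P. y \<subset> x \<and> card x = card y + 1} \<le> d * (T + 1)"
proof -
  obtain c where c: "c \<in> P" "x \<subseteq> c" using assms unfolding short_hull_def by blast
  have fx: "finite x" using assms finite_hull_member by blast
  let ?I = "{b \<in> cmp.nbhd P c. card (x - b) \<le> T + 1}"
  let ?B = "\<Union>b\<in>?I. (\<lambda>i. x - {i}) ` (x - b)"
  have "{y \<in> short_hull T P. y \<subset> x \<and> card x = card y + 1} \<subseteq> ?B"
  proof
    fix y assume y: "y \<in> {y \<in> short_hull T P. y \<subset> x \<and> card x = card y + 1}"
    then obtain b e where be: "y \<subset> x" "card x = card y + 1" "b \<in> P" "e \<in> P" "b \<subseteq> y" "y \<subseteq> e" "card (e - b) \<le> T"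
      unfolding short_hull_def by blast
    have "card (y - b) \<le> card (e - b)"
      using be finite_member[OF be(4)] by (intro card_mono) auto
    then have "card (x - b) \<le> T + 1"
      using card_Diff_cover_le(2)[OF fx be(1,2), of b] be by linarith
    moreover have "b \<in> cmp.nbhd P c" using c be unfolding cmp.nbhd_def comparable_def by blast
    moreover have "\<exists>i. i \<in> x - b \<and> y = x - {i}"
    proof -
      have "card (x - y) = 1" by (rule card_cover_Diff[OF fx be(1,2)])
      then obtain i where i: "x - y = {i}" by (rule card_1_singletonE)
      then have "y = x - {i}" using be(1) by blast
      moreover have "i \<in> x - b" using i be(5) by blast
      ultimately show ?thesis by blast
    qed
    ultimately show "y \<in> ?B" by blast
  qed
  moreover have "finite ?B"
    using fx finite_family by (auto simp: cmp.nbhd_def)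
  ultimately have "card {y \<in> short_hull T P. y \<subset> x \<and> card x = card y + 1} \<le> card ?B" by (rule card_mono[rotated])
  also have "\<dots> \<le> d * (T + 1)"
  proof (rule card_UN_le_mult)
    have "card ?I \<le> card (cmp.nbhd P c)" by (rule card_mono) (auto simp: finite_family)
    then show "card ?I \<le> d" using deg[OF c(1)] by simp
    fix b assume b: "b \<in> ?I"
    have "card ((\<lambda>i. x - {i}) ` (x - b)) \<le> card (x - b)"
      by (rule card_image_le) (use fx in simp)
    then show "card ((\<lambda>i. x - {i}) ` (x - b)) \<le> T + 1" using b by simp
  qed (simp add: finite_family)
  finally show ?thesis .
qed

lemma card_hull_le:
  assumes n: "card U \<ge> 4"
  defines "\<kappa> \<equiv> 2 * real (d * (T + 1)) / real (card U) + 16 * real (d * ((d + 1) * 2 ^ T)) / (real (card U))\<^sup>2"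
  assumes \<kappa>: "2 * \<kappa> < 1"
  shows "real (card (short_hull T P)) \<le> real (card U choose (card U div 2)) / (1 - 2 * \<kappa>) + 2 * real (card U) + 2"
proof -
  let ?n = "card U"
  define F where "F = {x \<in> short_hull T P. 2 \<le> card x \<and> card x + 2 \<le> ?n}"
  \<comment> \<open>The pair estimate needs room for two elements at both ends, so the sets of the
    four extreme sizes are counted separately.\<close>
  define R where "R = (\<Union>k\<in>{0, 1, ?n - 1, ?n}. {x. x \<subseteq> U \<and> card x = k})"
  have HU: "short_hull T P \<subseteq> Pow U" using PU by (rule hull_subset_Pow)
  have finH: "finite (short_hull T P)" using HU finU by (meson finite_Pow_iff finite_subset)
  have FH: "F \<subseteq> short_hull T P" unfolding F_def by blast
  have le: "card {y\<in>F. Q y} \<le> card {y \<in> short_hull T P. Q y}" for Q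
    by (rule card_mono) (use finH FH in auto)
  have "(1 - 2 * \<kappa>) * real (card F) \<le> real (?n choose (?n div 2))"
    unfolding \<kappa>_def
  proof (rule card_low_degree_family[OF finU n])
    fix x assume x: "x \<in> F"
    then have xH: "x \<in> short_hull T P" using FH by blast
    show "x \<subseteq> U \<and> 2 \<le> card x \<and> card x + 2 \<le> card U" using x HU unfolding F_def by blast
    show "card {y\<in>F. x \<subset> y \<and> card y = card x + 1} \<le> d * (T + 1)"
      by (rule order_trans[OF le hull_up_cover_degree[OF xH]])
    show "card {y\<in>F. x \<subset> y} \<le> d * ((d + 1) * 2 ^ T)"
      by (rule order_trans[OF le hull_up_degree[OF xH]])
    show "card {y\<in>F. y \<subset> x \<and> card x = card y + 1} \<le> d * (T + 1)"
      by (rule order_trans[OF le hull_down_cover_degree[OF xH]])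
    show "card {y\<in>F. y \<subset> x} \<le> d * ((d + 1) * 2 ^ T)"
      by (rule order_trans[OF le hull_down_degree[OF xH]])
  qed
  then have F: "real (card F) \<le> real (?n choose (?n div 2)) / (1 - 2 * \<kappa>)"
    using \<kappa> by (simp add: pos_le_divide_eq mult.commute)
  have finR: "finite R" unfolding R_def using finU by simp
  have "card R \<le> (\<Sum>k\<in>{0, 1, ?n - 1, ?n}. card {x. x \<subseteq> U \<and> card x = k})"
    unfolding R_def by (rule card_UN_le) simp
  also have "\<dots> = (\<Sum>k\<in>{0, 1, ?n - 1, ?n}. ?n choose k)"
    by (simp only: n_subsets[OF finU])
  also have "\<dots> = 2 * ?n + 2"
    using n binomial_symmetric[of 1 ?n] by (simp add: numeral_eq_Suc)
  finally have cR: "card R \<le> 2 * ?n + 2" .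
  have "short_hull T P \<subseteq> F \<union> R"
  proof
    fix x assume x: "x \<in> short_hull T P"
    then have "x \<subseteq> U" using HU by blast
    then have "card x \<le> ?n" using finU by (simp add: card_mono)
    then have "card x \<in> {0, 1, ?n - 1, ?n} \<or> (2 \<le> card x \<and> card x + 2 \<le> ?n)" by auto
    then show "x \<in> F \<union> R" using x \<open>x \<subseteq> U\<close> unfolding F_def R_def by auto
  qed
  then have "card (short_hull T P) \<le> card (F \<union> R)"
    by (rule card_mono[rotated]) (use finR finH FH finite_subset in auto)
  also have "\<dots> \<le> card F + card R" by (rule card_Un_le)
  finally show ?thesis using F cR by linarith
qed

end

text \<open>After branching, a remaining family costs half a bit per hull element and one bit per
  pair of a long matching, of which there are at most \<open>N / (T + 1)\<close>.\<close>

lemma num_Pow_le: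
  fixes U :: "'a set" and T \<phi> :: nat and x :: real
  assumes U: "finite U" "card U \<ge> 4"
    and x: "x > 0" "x * (1 + x) ^ \<phi> \<ge> 1"
  defines "\<kappa> \<equiv> 2 * real (\<phi> * (T + 1)) / real (card U) + 16 * real (\<phi> * ((\<phi> + 1) * 2 ^ T)) / (real (card U))\<^sup>2"
    and "N \<equiv> real (card U choose (card U div 2))"
  assumes \<kappa>: "2 * \<kappa> < 1"
  shows "real (cmp.num (Pow U)) \<le>
    (1 + x) ^ (2 ^ card U) * 2 powr ((N / (1 - 2 * \<kappa>) + 2 * real (card U) + 2) / 2 + N / real (T + 1))"
proof -
  have "real (cmp.num (Pow U)) \<le> (1 + x) ^ card (Pow U) *
      2 powr ((N / (1 - 2 * \<kappa>) + 2 * real (card U) + 2) / 2 + N / real (T + 1))"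
  proof (rule cmp.num_le_by_low_degree[OF x])
    fix P assume P: "P \<subseteq> Pow U" and low: "\<And>v. v \<in> P \<Longrightarrow> card (cmp.nbhd P v) < \<phi>"
    define t where "t = (card U choose (card U div 2)) div (T + 1)"
    have "card S \<le> t" if "long_matching T P S" for S
      using card_long_matching_le[OF U(1) P that] unfolding t_def by (simp add: less_eq_div_iff_mult_less_eq)
    then have "real (cmp.num P) \<le> sqrt 2 ^ card (short_hull T P) * 2 ^ t"
      by (rule num_le_hull[OF U(1) P])
    also have "\<dots> = 2 powr (real (card (short_hull T P)) / 2 + real t)"
      by (simp add: powr_add powr_realpow powr_half_sqrt[symmetric] powr_powr flip: powr_realpow)
    also have "\<dots> \<le> 2 powr ((N / (1 - 2 * \<kappa>) + 2 * real (card U) + 2) / 2 + N / real (T + 1))"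
    proof -
      have "real (card (short_hull T P)) \<le> N / (1 - 2 * \<kappa>) + 2 * real (card U) + 2"
        unfolding N_def \<kappa>_def
        by (rule card_hull_le[OF U(1) P _ U(2)]) (use low \<kappa> in \<open>auto simp: \<kappa>_def less_imp_le\<close>)
      moreover have "real t \<le> N / real (T + 1)"
        unfolding t_def N_def by (rule of_nat_div_le_of_nat)
      ultimately show ?thesis by (intro powr_mono add_mono divide_right_mono) auto
    qed
    finally show "real (cmp.num P) \<le> 2 powr ((N / (1 - 2 * \<kappa>) + 2 * real (card U) + 2) / 2 + N / real (T + 1))" .
  qed (use U in auto)
  then show ?thesis using U by (simp add: card_Pow)
qed

section \<open>The graphs and the poset of the theorem\<close>

lemma (in graph_rel) max_indep_eq_maximal_members:
  "max_indep A = maximal_members {I. I \<subseteq> A \<and> (\<forall>x\<in>I. \<forall>y\<in>I. \<not> E x y)}"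
proof (intro equalityI subsetI)
  fix I assume "I \<in> max_indep A"
  then show "I \<in> maximal_members {I. I \<subseteq> A \<and> (\<forall>x\<in>I. \<forall>y\<in>I. \<not> E x y)}"
    unfolding max_indep_def maximal_members_def by blast
next
  fix I assume "I \<in> maximal_members {I. I \<subseteq> A \<and> (\<forall>x\<in>I. \<forall>y\<in>I. \<not> E x y)}"
  then have I: "I \<subseteq> A" "\<forall>u\<in>I. \<forall>v\<in>I. \<not> E u v"
    and max: "\<And>B. B \<subseteq> A \<Longrightarrow> \<forall>u\<in>B. \<forall>v\<in>B. \<not> E u v \<Longrightarrow> I \<subseteq> B \<Longrightarrow> B = I"
    unfolding maximal_members_def by simp_all
  have "\<exists>y\<in>I. E x y" if x: "x \<in> A - I" for x
  proof (rule ccontr)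
    assume "\<not> ?thesis"
    then have "\<forall>u\<in>insert x I. \<forall>v\<in>insert x I. \<not> E u v"
      using I(2) sym irrefl by blast
    then have "insert x I = I" using I(1) x by (intro max) auto
    then show False using x by blast
  qed
  then show "I \<in> max_indep A"
    using I unfolding max_indep_def by simp
qed

lemma num_bij_le:
  assumes "graph_rel E" "graph_rel E'" "bij_betw f A B" "finite A"
    and "\<And>x y. x \<in> A \<Longrightarrow> y \<in> A \<Longrightarrow> E x y \<longleftrightarrow> E' (f x) (f y)"
  shows "graph_rel.num E A \<le> graph_rel.num E' B"
proof -
  interpret E: graph_rel E by fact
  interpret E': graph_rel E' by fact
  have f: "inj_on f A" "f ` A = B" using assms(3) by (auto simp: bij_betw_def)
  show ?thesis unfolding E.num_def E'.num_def
  proof (rule card_inj_on_le)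
    show "inj_on ((`) f) (E.max_indep A)"
      by (rule inj_on_subset[OF inj_on_image_Pow[OF f(1)]]) (auto simp: E.max_indep_def)
    show "(`) f ` E.max_indep A \<subseteq> E'.max_indep B"
    proof (rule image_subsetI)
      fix I assume I: "I \<in> E.max_indep A"
      then have "I \<subseteq> A" by (simp add: E.max_indep_def)
      have "\<exists>y\<in>f ` I. E' x y" if x: "x \<in> B - f ` I" for x
      proof -
        obtain u where u: "u \<in> A - I" "x = f u" using x f(2) by blast
        then obtain v where "v \<in> I" "E u v" using I unfolding E.max_indep_def by blast
        then show ?thesis using u assms(5)[of u v] \<open>I \<subseteq> A\<close> by blast
      qed
      moreover have "\<not> E' x y" if xy: "x \<in> f ` I" "y \<in> f ` I" for x y
      proof -
        obtain u v where "u \<in> I" "v \<in> I" "x = f u" "y = f v" using xy by blast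
        then show ?thesis
          using I assms(5)[of u v] \<open>I \<subseteq> A\<close> unfolding E.max_indep_def by blast
      qed
      ultimately show "f ` I \<in> E'.max_indep B"
        using \<open>I \<subseteq> A\<close> f(2) unfolding E'.max_indep_def by blast
    qed
    show "finite (E'.max_indep B)"
      using assms(4) f(2) by (intro E'.finite_max_indep) auto
  qed
qed

lemma num_bij:
  assumes "graph_rel E" "graph_rel E'" "bij_betw f A B" "finite A"
    and "\<And>x y. x \<in> A \<Longrightarrow> y \<in> A \<Longrightarrow> E x y \<longleftrightarrow> E' (f x) (f y)"
  shows "graph_rel.num E A = graph_rel.num E' B"
proof (rule antisym)
  show "graph_rel.num E A \<le> graph_rel.num E' B" by (rule num_bij_le[OF assms])
  have inv: "inv_into A f y \<in> A" "f (inv_into A f y) = y" if "y \<in> B" for y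
    using that assms(3) by (auto simp: bij_betw_def inv_into_into f_inv_into_f)
  show "graph_rel.num E' B \<le> graph_rel.num E A"
    by (rule num_bij_le[OF assms(2,1) bij_betw_inv_into[OF assms(3)]])
      (use assms(3,4,5) inv in \<open>auto simp: bij_betw_finite\<close>)
qed

lemma ma_boolean_algebra: "ma (boolean_algebra n) = cmp.num (Pow {1..n})"
proof -
  have "{A. antichain (Pow {1..n}) A} = {A. A \<subseteq> Pow {1..n} \<and> (\<forall>x\<in>A. \<forall>y\<in>A. \<not> comparable x y)}"
    unfolding antichain_def pairwise_def comparable_def by blast
  then show ?thesis
    unfolding ma_def cmp.num_def cmp.max_indep_eq_maximal_members boolean_algebra_def by (simp only:)
qed

text \<open>The clause \<open>x \<noteq> y\<close> gives irreflexivity for every edge set and agrees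
  with \<open>indep\<close>, which only inspects distinct vertices.\<close>

definition adjacent :: "'a graph \<Rightarrow> 'a \<Rightarrow> 'a \<Rightarrow> bool" where
  "adjacent G x y \<longleftrightarrow> x \<noteq> y \<and> {x, y} \<in> snd G"

interpretation adj: graph_rel "adjacent G" for G
  by unfold_locales (auto simp: adjacent_def insert_commute)

lemma mis_eq_num: "mis G = adj.num G (fst G)"
proof -
  have "{A. independent_set G A} = {A. A \<subseteq> fst G \<and> (\<forall>x\<in>A. \<forall>y\<in>A. \<not> adjacent G x y)}"
    unfolding independent_set_def indep_def adjacent_def by blast
  then show ?thesis
    unfolding mis_def adj.num_def adj.max_indep_eq_maximal_members by (simp only:)
qed

text \<open>Adjacency in the Hasse diagram, which is hypercube adjacency once strings are replaced
  by their supports.\<close>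

definition covering :: "'a set \<Rightarrow> 'a set \<Rightarrow> bool" where
  "covering x y \<longleftrightarrow> (x \<subset> y \<and> card y = card x + 1) \<or> (y \<subset> x \<and> card x = card y + 1)"

interpretation cov: graph_rel covering
  by unfold_locales (auto simp: covering_def)

lemma
  shows covering_up: "card x < card y \<Longrightarrow> covering x y \<longleftrightarrow> x \<subset> y \<and> card y = card x + 1"
    and covering_down: "card y < card x \<Longrightarrow> covering x y \<longleftrightarrow> y \<subset> x \<and> card x = card y + 1"
    and not_covering: "card x = card y \<Longrightarrow> \<not> covering x y"
  unfolding covering_def by linarith+

lemma covering_insert: "finite x \<Longrightarrow> i \<notin> x \<Longrightarrow> covering x (insert i x)"
  by (auto simp: covering_def)

lemma covering_iff_unique_diff:
  assumes "finite U" "x \<subseteq> U" "y \<subseteq> U"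
  shows "covering x y \<longleftrightarrow> (\<exists>!i. i \<in> U \<and> (i \<in> x) \<noteq> (i \<in> y))"
proof
  have fin: "finite x" "finite y" using assms finite_subset by blast+
  have *: "\<exists>!i. i \<in> U \<and> (i \<in> a) \<noteq> (i \<in> b)" if "finite b" "a \<subset> b" "card b = card a + 1" "b \<subseteq> U" for a b
  proof -
    have "card (b - a) = 1" using that(1,2,3) by (rule card_cover_Diff)
    then obtain i where "b - a = {i}" by (rule card_1_singletonE)
    then show ?thesis using that by (intro ex1I[of _ i]) blast+
  qed
  assume "covering x y"
  then show "\<exists>!i. i \<in> U \<and> (i \<in> x) \<noteq> (i \<in> y)"
    using *[of y x] *[of x y] fin assms unfolding covering_def by metis
next
  have fin: "finite x" "finite y" using assms finite_subset by blast+
  assume "\<exists>!i. i \<in> U \<and> (i \<in> x) \<noteq> (i \<in> y)"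
  then obtain i where i: "(i \<in> x) \<noteq> (i \<in> y)" "\<And>j. j \<in> U \<Longrightarrow> j \<noteq> i \<Longrightarrow> (j \<in> x) = (j \<in> y)"
    by blast
  show "covering x y"
  proof (cases "i \<in> x")
    case True
    then have "x = insert i y" "i \<notin> y" using i assms by blast+
    then show ?thesis using covering_insert[OF fin(2), of i] cov.sym by blast
  next
    case False
    then have "y = insert i x" using i assms by blast
    then show ?thesis using covering_insert[OF fin(1), of i] False by blast
  qed
qed

definition support :: "nat \<Rightarrow> (nat \<Rightarrow> nat) \<Rightarrow> nat set" where
  "support n x = {i \<in> {1..n}. x i = 1}"

lemma bij_betw_support: "bij_betw (support n) (strings n) (Pow {1..n})"
proof (rule bij_betw_byWitness[where f' = "\<lambda>A i. if i \<in> {1..n} then of_bool (i \<in> A) else undefined"])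
  show "\<forall>x\<in>strings n. (\<lambda>i. if i \<in> {1..n} then of_bool (i \<in> support n x) else undefined) = x"
  proof
    fix x assume x: "x \<in> strings n"
    show "(\<lambda>i. if i \<in> {1..n} then of_bool (i \<in> support n x) else undefined) = x"
    proof
      fix i
      show "(if i \<in> {1..n} then of_bool (i \<in> support n x) else undefined) = x i"
        using x unfolding strings_def support_def by (auto simp: PiE_def Pi_def extensional_def)
    qed
  qed
  show "\<forall>A\<in>Pow {1..n}. support n (\<lambda>i. if i \<in> {1..n} then of_bool (i \<in> A) else undefined) = A"
    by (auto simp: support_def split: if_splits)
  show "support n ` strings n \<subseteq> Pow {1..n}" by (auto simp: support_def)
  show "(\<lambda>A i. if i \<in> {1..n} then of_bool (i \<in> A) else undefined) ` Pow {1..n} \<subseteq> strings n"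
    by (auto simp: strings_def)
qed

lemma finite_strings: "finite (strings n)"
  unfolding strings_def by (intro finite_PiE) auto

lemma adjacent_hypercube_iff:
  assumes "x \<in> strings n" "y \<in> strings n"
  shows "adjacent (hypercube n) x y \<longleftrightarrow> covering (support n x) (support n y)"
proof -
  have val: "x i \<in> {0, 1}" "y i \<in> {0, 1}" if "i \<in> {1..n}" for i
    using assms that by (auto simp: strings_def)
  have "adjacent (hypercube n) x y \<longleftrightarrow> (\<exists>!i. i \<in> {1..n} \<and> x i \<noteq> y i)"
  proof
    assume "adjacent (hypercube n) x y"
    then obtain a b where ab: "{x, y} = {a, b}" "\<exists>!i. i \<in> {1..n} \<and> a i \<noteq> b i"
      unfolding adjacent_def hypercube_def snd_conv mem_Collect_eq by blast
    have "(\<lambda>i. i \<in> {1..n} \<and> b i \<noteq> a i) = (\<lambda>i. i \<in> {1..n} \<and> a i \<noteq> b i)" by auto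
    then show "\<exists>!i. i \<in> {1..n} \<and> x i \<noteq> y i"
      using ab unfolding doubleton_eq_iff by (elim disjE) simp_all
  next
    assume "\<exists>!i. i \<in> {1..n} \<and> x i \<noteq> y i"
    then show "adjacent (hypercube n) x y"
      using assms unfolding adjacent_def hypercube_def snd_conv mem_Collect_eq by blast
  qed
  also have "\<dots> \<longleftrightarrow> (\<exists>!i. i \<in> {1..n} \<and> (i \<in> support n x) \<noteq> (i \<in> support n y))"
  proof -
    have "(i \<in> {1..n} \<and> x i \<noteq> y i) \<longleftrightarrow> (i \<in> {1..n} \<and> (i \<in> support n x) \<noteq> (i \<in> support n y))" for i
      using val[of i] unfolding support_def by auto
    then show ?thesis by simp
  qed
  also have "\<dots> \<longleftrightarrow> covering (support n x) (support n y)"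
    by (rule covering_iff_unique_diff[symmetric]) (auto simp: support_def)
  finally show ?thesis .
qed

lemma mis_hypercube: "mis (hypercube n) = cov.num (Pow {1..n})"
proof -
  have "fst (hypercube n) = strings n" by (simp add: hypercube_def)
  moreover have "adj.num (hypercube n) (strings n) = cov.num (Pow {1..n})"
    by (rule num_bij[OF adj.graph_rel_axioms cov.graph_rel_axioms bij_betw_support finite_strings
          adjacent_hypercube_iff])
  ultimately show ?thesis by (simp only: mis_eq_num)
qed

definition layer :: "'a set \<Rightarrow> nat \<Rightarrow> 'a set set" where
  "layer U k = {x. x \<subseteq> U \<and> card x = k}"

lemma mis_two_layers: "mis (two_layers n k) = cov.num (layer {1..n} k \<union> layer {1..n} (k + 1))"
proof -
  let ?A = "{x \<in> strings n. ones n x = k \<or> ones n x = k + 1}"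
  have "fst (two_layers n k) = ?A"
    by (auto simp: two_layers_def induced_subgraph_def hypercube_def)
  moreover have "adj.num (two_layers n k) ?A = cov.num (layer {1..n} k \<union> layer {1..n} (k + 1))"
  proof (rule num_bij[OF adj.graph_rel_axioms cov.graph_rel_axioms, where f = "support n"])
    have ones: "ones n x = card (support n x)" for x
      by (simp add: ones_def support_def)
    have "support n ` ?A = layer {1..n} k \<union> layer {1..n} (k + 1)"
    proof
      show "support n ` ?A \<subseteq> layer {1..n} k \<union> layer {1..n} (k + 1)"
        by (auto simp: layer_def ones support_def)
      show "layer {1..n} k \<union> layer {1..n} (k + 1) \<subseteq> support n ` ?A"
      proof
        fix y assume y: "y \<in> layer {1..n} k \<union> layer {1..n} (k + 1)"
        then have "y \<in> support n ` strings n"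
          using bij_betw_support[of n] by (auto simp: layer_def bij_betw_def)
        then obtain x where "x \<in> strings n" "y = support n x" by blast
        then show "y \<in> support n ` ?A" using y by (auto simp: layer_def ones)
      qed
    qed
    then show "bij_betw (support n) ?A (layer {1..n} k \<union> layer {1..n} (k + 1))"
      using bij_betw_support[of n] by (auto simp: bij_betw_def intro: inj_on_subset)
    show "finite ?A" using finite_strings by simp
    fix x y assume xy: "x \<in> ?A" "y \<in> ?A"
    then have "adjacent (two_layers n k) x y \<longleftrightarrow> adjacent (hypercube n) x y"
      by (auto simp: adjacent_def two_layers_def induced_subgraph_def)
    then show "adjacent (two_layers n k) x y \<longleftrightarrow> covering (support n x) (support n y)"
      using adjacent_hypercube_iff xy by simp
  qed
  ultimately show ?thesis by (simp add: mis_eq_num)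
qed

section \<open>Upper bounds for two layers and for the hypercube\<close>

lemma up_covers_eq:
  assumes "finite U" "x \<subseteq> U"
  shows "{y. y \<subseteq> U \<and> x \<subset> y \<and> card y = card x + 1} = (\<lambda>i. insert i x) ` (U - x)"
proof (intro equalityI subsetI)
  fix y assume y: "y \<in> {y. y \<subseteq> U \<and> x \<subset> y \<and> card y = card x + 1}"
  then have "finite y" using assms finite_subset by blast
  then obtain i where "y - x = {i}" using card_cover_Diff[of y x] y card_1_singletonE by blast
  then have "y = insert i x" "i \<in> U - x" using y by blast+
  then show "y \<in> (\<lambda>i. insert i x) ` (U - x)" by blast
next
  fix y assume "y \<in> (\<lambda>i. insert i x) ` (U - x)"
  then show "y \<in> {y. y \<subseteq> U \<and> x \<subset> y \<and> card y = card x + 1}"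
    using assms finite_subset[OF assms(2,1)] by auto
qed

lemma card_up_covers:
  assumes "finite U" "x \<subseteq> U"
  shows "card {y. y \<subseteq> U \<and> x \<subset> y \<and> card y = card x + 1} = card U - card x"
proof -
  have "inj_on (\<lambda>i. insert i x) (U - x)" by (auto simp: inj_on_def)
  then show ?thesis
    using assms by (simp add: up_covers_eq[OF assms, simplified] card_image card_Diff_subset finite_subset)
qed

lemma down_covers_eq:
  assumes "finite x"
  shows "{y. y \<subset> x \<and> card x = card y + 1} = (\<lambda>i. x - {i}) ` x"
proof (intro equalityI subsetI)
  fix y assume y: "y \<in> {y. y \<subset> x \<and> card x = card y + 1}"
  then obtain i where "x - y = {i}" using card_cover_Diff[of x y] assms card_1_singletonE by blast
  then have "y = x - {i}" "i \<in> x" using y by blast+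
  then show "y \<in> (\<lambda>i. x - {i}) ` x" by blast
next
  fix y assume "y \<in> (\<lambda>i. x - {i}) ` x"
  then obtain i where i: "i \<in> x" "y = x - {i}" by blast
  then have "card x = card y + 1" using assms card_Suc_Diff1[of x i] by simp
  then show "y \<in> {y. y \<subset> x \<and> card x = card y + 1}" using i by blast
qed

lemma card_down_covers:
  assumes "finite x"
  shows "card {y. y \<subset> x \<and> card x = card y + 1} = card x"
proof -
  have "inj_on (\<lambda>i. x - {i}) x" by (auto simp: inj_on_def)
  then show ?thesis using down_covers_eq[OF assms] by (simp add: card_image)
qed

lemma finite_layer: "finite U \<Longrightarrow> finite (layer U k)"
  by (simp add: layer_def)

lemma card_layer: "finite U \<Longrightarrow> card (layer U k) = card U choose k"
  by (simp add: layer_def n_subsets)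

text \<open>With \<open>n = card U\<close> the degrees are \<open>n - k\<close> and
  \<open>k + 1\<close>. Their sum does not depend on \<open>k\<close>, and the number of edges is
  \<open>n * ((n - 1) choose k)\<close>, so the exponent is near the target when
  \<open>\<phi>\<close> is \<open>o(n)\<close>.\<close>

lemma num_two_layers_le:
  fixes x :: real
  assumes U: "finite U" "k < card U"
    and x: "x > 0" "x * (1 + x) ^ \<phi> \<ge> 1" "\<phi> \<le> card U"
  shows "real (cov.num (layer U k \<union> layer U (k + 1))) \<le>
    (1 + x) ^ ((card U + 1) choose (k + 1)) *
      2 powr (real (card U * ((card U - 1) choose k)) / real (card U + 1 - \<phi>))"
proof -
  let ?n = "card U"
  have "real (cov.num (layer U k \<union> layer U (k + 1))) \<le>
    (1 + x) ^ (card (layer U k) + card (layer U (k + 1))) *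
      2 powr (real ((?n - k) * card (layer U k)) / real ((?n - k) + (k + 1) - \<phi>))"
  proof (rule cov.num_biregular_le[OF _ _ _ _ _ _ _ x(1,2)])
    show "card (cov.nbhd (layer U (k + 1)) y) = ?n - k" if "y \<in> layer U k" for y
    proof -
      have "cov.nbhd (layer U (k + 1)) y = {z. z \<subseteq> U \<and> y \<subset> z \<and> card z = card y + 1}"
        using that by (auto simp: cov.nbhd_def layer_def covering_up)
      then show ?thesis using card_up_covers[OF U(1), of y] that by (simp add: layer_def)
    qed
    show "card (cov.nbhd (layer U k) y) = k + 1" if "y \<in> layer U (k + 1)" for y
    proof -
      have "cov.nbhd (layer U k) y = {z. z \<subset> y \<and> card y = card z + 1}"
        using that by (auto simp: cov.nbhd_def layer_def covering_down)
      then show ?thesis using card_down_covers[of y] that finite_subset[OF _ U(1), of y]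
        by (simp add: layer_def)
    qed
  qed (use U x(3) in \<open>auto simp: finite_layer layer_def not_covering\<close>)
  moreover have "card (layer U k) + card (layer U (k + 1)) = (?n + 1) choose (k + 1)"
    using U by (simp add: card_layer)
  moreover have "(?n - k) * card (layer U k) = ?n * ((?n - 1) choose k)"
    using U by (simp add: card_layer binomial_absorb_comp)
  moreover have "(?n - k) + (k + 1) - \<phi> = ?n + 1 - \<phi>" using U by simp
  ultimately show ?thesis by simp
qed

text \<open>Each layer is independent, so the trace on the other one determines the set. This serves
  the values of \<open>k\<close> near an end.\<close>

lemma num_two_layers_le_trivial:
  assumes "finite U"
  shows "cov.num (layer U k \<union> layer U (k + 1)) \<le> 2 ^ (card U choose k)"
    "cov.num (layer U k \<union> layer U (k + 1)) \<le> 2 ^ (card U choose (k + 1))"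
proof -
  have "cov.num (layer U k \<union> layer U (k + 1)) \<le> 2 ^ card (layer U k)"
    by (rule cov.num_le_two_power_card) (use assms in \<open>auto simp: finite_layer layer_def not_covering\<close>)
  then show "cov.num (layer U k \<union> layer U (k + 1)) \<le> 2 ^ (card U choose k)"
    using assms by (simp add: card_layer)
  have "cov.num (layer U k \<union> layer U (k + 1)) \<le> 2 ^ card (layer U (k + 1))"
    by (rule cov.num_le_two_power_card) (use assms in \<open>auto simp: finite_layer layer_def not_covering\<close>)
  then show "cov.num (layer U k \<union> layer U (k + 1)) \<le> 2 ^ (card U choose (k + 1))"
    using assms by (simp add: card_layer)
qed

text \<open>Toggling a fixed element is an involution that reverses parity.\<close>

lemma card_even_odd_subsets:
  assumes "finite U" "U \<noteq> {}"
  shows "card {x. x \<subseteq> U \<and> even (card x)} = 2 ^ (card U - 1)"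
    "card {x. x \<subseteq> U \<and> odd (card x)} = 2 ^ (card U - 1)"
proof -
  let ?X = "{x. x \<subseteq> U \<and> even (card x)}" and ?Y = "{x. x \<subseteq> U \<and> odd (card x)}"
  obtain u where u: "u \<in> U" using assms by blast
  define f where "f x = (if u \<in> x then x - {u} else insert u x)" for x
  have f: "f (f x) = x" "f x \<subseteq> U" "even (card (f x)) \<longleftrightarrow> odd (card x)" if "x \<subseteq> U" for x
  proof -
    have "finite x" using that assms finite_subset by blast
    then show "even (card (f x)) \<longleftrightarrow> odd (card x)"
      using card_Suc_Diff1[of x u] unfolding f_def by (auto simp flip: even_Suc)
  qed (use that u in \<open>auto simp: f_def\<close>)
  have "bij_betw f ?X ?Y"
    by (rule bij_betw_byWitness[where f' = f]) (use f in auto)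
  then have eq: "card ?X = card ?Y" by (rule bij_betw_same_card)
  have "card (?X \<union> ?Y) = card ?X + card ?Y"
    by (rule card_Un_disjoint) (use assms in auto)
  moreover have "?X \<union> ?Y = Pow U" by auto
  ultimately have "2 ^ card U = card ?X + card ?Y" using assms by (simp add: card_Pow)
  moreover have "2 ^ card U = 2 * (2 :: nat) ^ (card U - 1)"
    using assms by (metis card_gt_0_iff power_eq_if not_gr0)
  ultimately show "card ?X = 2 ^ (card U - 1)" "card ?Y = 2 ^ (card U - 1)" using eq by simp_all
qed

text \<open>The parity classes are the two sides and all degrees are \<open>n = card U\<close>, so
  without the correction \<open>\<phi>\<close> the exponent would be
  \<open>2 ^ (n - 1) / 2\<close>.\<close>

lemma num_hypercube_le:
  fixes x :: real
  assumes U: "finite U" "U \<noteq> {}"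
    and x: "x > 0" "x * (1 + x) ^ \<phi> \<ge> 1" "\<phi> \<le> card U"
  shows "real (cov.num (Pow U)) \<le>
    (1 + x) ^ (2 ^ card U) * 2 powr (real (card U * 2 ^ (card U - 1)) / real (2 * card U - \<phi>))"
proof -
  let ?n = "card U"
  let ?X = "{x. x \<subseteq> U \<and> even (card x)}" and ?Y = "{x. x \<subseteq> U \<and> odd (card x)}"
  have n: "?n > 0" using U by (simp add: card_gt_0_iff)
  have nbhd: "card (cov.nbhd {z. z \<subseteq> U \<and> Q z} y) = ?n"
    if y: "y \<subseteq> U" and Q: "\<And>z. covering y z \<Longrightarrow> Q z" for y Q
  proof -
    let ?A = "{z. z \<subseteq> U \<and> y \<subset> z \<and> card z = card y + 1}" and ?B = "{z. z \<subset> y \<and> card y = card z + 1}"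
    have "cov.nbhd {z. z \<subseteq> U \<and> Q z} y = ?A \<union> ?B"
      using y Q by (auto simp: cov.nbhd_def covering_def)
    moreover have "finite ?A" "finite ?B" "?A \<inter> ?B = {}"
      using U(1) y finite_subset[OF y U(1)] by (auto intro: finite_subset[of _ "Pow U"])
    ultimately have "card (cov.nbhd {z. z \<subseteq> U \<and> Q z} y) = card ?A + card ?B"
      by (simp only: card_Un_disjoint)
    moreover have "card ?A = ?n - card y" by (rule card_up_covers[OF U(1) y])
    moreover have "card ?B = card y" by (rule card_down_covers[OF finite_subset[OF y U(1)]])
    moreover have "card y \<le> ?n" using U y by (simp add: card_mono)
    ultimately show ?thesis by linarith
  qed
  have "real (cov.num (?X \<union> ?Y)) \<le> (1 + x) ^ (card ?X + card ?Y) *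
      2 powr (real (?n * card ?X) / real (?n + ?n - \<phi>))"
  proof (rule cov.num_biregular_le[OF _ _ _ _ _ _ _ x(1,2)])
    show "card (cov.nbhd ?Y y) = ?n" if "y \<in> ?X" for y
      by (rule nbhd) (use that in \<open>auto simp: covering_def\<close>)
    show "card (cov.nbhd ?X y) = ?n" if "y \<in> ?Y" for y
      by (rule nbhd) (use that in \<open>auto simp: covering_def\<close>)
  qed (use U n x(3) in \<open>auto simp: covering_def\<close>)
  moreover have "?X \<union> ?Y = Pow U" by auto
  moreover have "card ?X = 2 ^ (?n - 1)" "card ?Y = 2 ^ (?n - 1)"
    using card_even_odd_subsets[OF U] by simp_all
  moreover have "2 ^ (?n - 1) + 2 ^ (?n - 1) = (2 :: nat) ^ ?n"
    using n by (cases ?n) auto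
  ultimately show ?thesis by (simp add: mult_2)
qed

section \<open>Lower bounds from induced matchings\<close>

text \<open>Fixing the size \<open>k\<close> makes the matching induced: if \<open>x\<close> lies
  below \<open>insert u y\<close>, then it lies below \<open>y\<close> and has the same size, so
  they are equal.\<close>

lemma num_comparable_ge:
  assumes "finite U" "u \<in> U"
  shows "2 ^ ((card U - 1) choose k) \<le> cmp.num (Pow U)"
proof -
  let ?J = "layer (U - {u}) k"
  have inj: "x \<subseteq> insert u y \<Longrightarrow> x = y" if "x \<in> ?J" "y \<in> ?J" for x y
  proof -
    assume "x \<subseteq> insert u y"
    then have "x \<subseteq> y" "card x = card y" "y \<subseteq> U" using that by (auto simp: layer_def)
    then show ?thesis using card_subset_eq[of y x] finite_subset[of y U] assms(1) by simp
  qed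
  have "2 ^ card ?J \<le> cmp.num (Pow U)"
  proof (rule cmp.num_ge_induced_matching[where a = "\<lambda>x. x" and b = "insert u"])
    fix x y assume xy: "x \<in> ?J" "y \<in> ?J" "x \<noteq> y"
    then have "u \<notin> x" "u \<notin> y" by (auto simp: layer_def)
    then show "x \<noteq> y \<and> \<not> comparable x y \<and> \<not> comparable x (insert u y) \<and> \<not> comparable (insert u x) (insert u y)"
      using xy inj[of x y] inj[of y x] unfolding comparable_def by blast
  qed (use assms in \<open>auto simp: finite_layer layer_def comparable_def\<close>)
  then show ?thesis using assms by (simp add: card_layer)
qed

text \<open>Unlike for comparability, members of \<open>J\<close> may differ in size, as the even
  sets do. If \<open>insert u y\<close> covers \<open>x\<close>, then \<open>x\<close> lies in
  \<open>y\<close> and has its size; a covering of \<open>insert u x\<close> and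
  \<open>insert u y\<close> descends to \<open>x\<close> and \<open>y\<close>.\<close>

lemma num_covering_ge:
  assumes "finite U" "u \<in> U" "finite V" "J \<subseteq> Pow (U - {u})" "J \<union> insert u ` J \<subseteq> V"
    and nc: "\<And>x y. x \<in> J \<Longrightarrow> y \<in> J \<Longrightarrow> \<not> covering x y"
  shows "2 ^ card J \<le> cov.num V"
proof (rule cov.num_ge_induced_matching[where a = "\<lambda>x. x" and b = "insert u"])
  have J: "finite x" "u \<notin> x" if "x \<in> J" for x
    using that assms(1,4) finite_subset[of x U] by auto
  show "x \<in> V \<and> insert u x \<in> V \<and> covering x (insert u x)" if "x \<in> J" for x
    using that assms(5) covering_insert[OF J[OF that]] by auto
  fix x y assume xy: "x \<in> J" "y \<in> J" "x \<noteq> y"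
  have "\<not> covering x (insert u y)"
  proof
    assume "covering x (insert u y)"
    moreover have "\<not> insert u y \<subset> x" using J(2)[OF xy(1)] by blast
    ultimately have "x \<subset> insert u y" "card (insert u y) = card x + 1"
      unfolding covering_def by blast+
    then have "x \<subseteq> y" "card x = card y" using J[OF xy(1)] J[OF xy(2)] by auto
    then show False using xy(3) card_subset_eq[of y x] J[OF xy(2)] by simp
  qed
  moreover have "\<not> covering (insert u x) (insert u y)"
  proof
    assume "covering (insert u x) (insert u y)"
    moreover have "card (insert u x) = card x + 1" "card (insert u y) = card y + 1"
      using J[OF xy(1)] J[OF xy(2)] by simp_all
    moreover have "insert u x \<subset> insert u y \<longleftrightarrow> x \<subset> y" "insert u y \<subset> insert u x \<longleftrightarrow> y \<subset> x"
      using J(2)[OF xy(1)] J(2)[OF xy(2)] by (simp_all add: psubset_eq insert_ident subset_insert)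
    ultimately have "covering x y" unfolding covering_def by linarith
    then show False using nc xy by blast
  qed
  ultimately show "x \<noteq> y \<and> \<not> covering x y \<and> \<not> covering x (insert u y) \<and> \<not> covering (insert u x) (insert u y)"
    using xy nc by blast
next
  show "finite J" using assms by (meson finite_Diff finite_Pow_iff finite_subset)
qed (use assms in simp)

lemma num_hypercube_ge:
  assumes "finite U" "card U \<ge> 2"
  shows "2 ^ 2 ^ (card U - 2) \<le> cov.num (Pow U)"
proof -
  obtain u where u: "u \<in> U" using assms by fastforce
  let ?J = "{x. x \<subseteq> U - {u} \<and> even (card x)}"
  have "card (U - {u}) = card U - 1" using u by simp
  moreover have "U - {u} \<noteq> {}" using assms(2) u \<open>card (U - {u}) = card U - 1\<close>
    by (metis Suc_1 card.empty diff_is_0_eq not_less_eq_eq)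
  ultimately have "card ?J = 2 ^ (card U - 2)"
    using card_even_odd_subsets(1)[of "U - {u}"] assms by (simp add: numeral_2_eq_2)
  moreover have "2 ^ card ?J \<le> cov.num (Pow U)"
    by (rule num_covering_ge[OF assms(1) u]) (use assms u in \<open>auto simp: covering_def\<close>)
  ultimately show ?thesis by simp
qed

lemma num_two_layers_ge:
  assumes "finite U" "k < card U"
  shows "2 ^ ((card U - 1) choose k) \<le> cov.num (layer U k \<union> layer U (k + 1))"
proof -
  obtain u where u: "u \<in> U" using assms by fastforce
  have "2 ^ card (layer (U - {u}) k) \<le> cov.num (layer U k \<union> layer U (k + 1))"
  proof (rule num_covering_ge[OF assms(1) u])
    show "layer (U - {u}) k \<union> insert u ` layer (U - {u}) k \<subseteq> layer U k \<union> layer U (k + 1)"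
    proof -
      have "insert u x \<in> layer U (k + 1)" if "x \<in> layer (U - {u}) k" for x
      proof -
        have "finite x" "u \<notin> x" using that assms(1) by (auto simp: layer_def intro: finite_subset)
        then show ?thesis using that u by (auto simp: layer_def)
      qed
      then show ?thesis by (auto simp: layer_def)
    qed
  qed (use assms in \<open>auto simp: finite_layer layer_def not_covering\<close>)
  then show ?thesis using assms u by (simp add: card_layer)
qed

section \<open>Asymptotics\<close>

text \<open>The bound \<open>4 ^ m \<le> 2 * sqrt m * ((2 * m) choose m)\<close>, squared to stay in
  the naturals. Consecutive central coefficients have ratio
  \<open>2 * (2 * m + 1) / (m + 1)\<close>, and
  \<open>4 * m * (m + 1) \<le> (2 * m + 1)\<^sup>2\<close>.\<close>

lemma central_binomial_sq_ge:
  assumes "m \<ge> 1"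
  shows "16 ^ m \<le> 4 * m * ((2 * m) choose m)\<^sup>2"
  using assms
proof (induction m rule: dec_induct)
  case base
  then show ?case by (simp add: numeral_2_eq_2)
next
  case (step m)
  let ?C = "(2 * m) choose m" and ?D = "(2 * Suc m) choose Suc m"
  have "Suc m * ((2 * m + 1) choose m) = (2 * m + 1) * ?C"
    using binomial_absorb_comp[of "2 * m + 1" m] by simp
  moreover have "Suc (2 * m + 1) * ((2 * m + 1) choose m) = ?D * Suc m"
    using Suc_times_binomial_eq[of "2 * m + 1" m] by simp
  moreover have "Suc (2 * m + 1) * ((2 * m + 1) choose m) = 2 * (Suc m * ((2 * m + 1) choose m))"
    by simp
  ultimately have D: "Suc m * ?D = 2 * (2 * m + 1) * ?C" by (simp add: mult_ac)
  have "Suc m * 16 ^ Suc m = 16 * (Suc m * 16 ^ m)" by simp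
  also have "\<dots> \<le> 16 * (Suc m * (4 * m * ?C\<^sup>2))"
    using step.IH by (intro mult_left_mono) auto
  also have "\<dots> = 16 * (4 * m * Suc m) * ?C\<^sup>2" by (simp only: mult_ac)
  also have "\<dots> \<le> 16 * (2 * m + 1)\<^sup>2 * ?C\<^sup>2"
    by (intro mult_right_mono mult_left_mono) (auto simp: power2_eq_square)
  also have "\<dots> = 4 * (2 * (2 * m + 1) * ?C)\<^sup>2" by (simp only: power_mult_distrib) simp
  also have "\<dots> = Suc m * (4 * Suc m * ?D\<^sup>2)" unfolding D[symmetric] by (simp only: power2_eq_square mult_ac)
  finally show ?case by (simp only: Suc_mult_le_cancel1)
qed

lemma two_power_le_middle_binomial:
  assumes "n \<ge> 1"
  shows "2 ^ n \<le> 2 * sqrt (real n) * real (n choose (n div 2))"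
proof -
  have "(2 ^ n)\<^sup>2 \<le> 4 * n * (n choose (n div 2))\<^sup>2"
  proof (cases "even n")
    case True
    then obtain m where m: "n = 2 * m" by blast
    have "(2 ^ n)\<^sup>2 = (16 :: nat) ^ m" unfolding m by (simp flip: power_mult) (simp add: power_mult)
    also have "\<dots> \<le> 4 * m * ((2 * m) choose m)\<^sup>2"
      using assms m by (intro central_binomial_sq_ge) simp
    also have "\<dots> \<le> 4 * n * ((2 * m) choose m)\<^sup>2"
      by (intro mult_right_mono) (auto simp: m)
    also have "\<dots> = 4 * n * (n choose (n div 2))\<^sup>2" by (simp add: m)
    finally show ?thesis .
  next
    case False
    then obtain m where m: "n = 2 * m + 1" by (rule oddE)
    \<comment> \<open>For odd \<open>n\<close> the middle coefficient is half of the next central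
      one.\<close>
    have "Suc m * ((2 * Suc m) choose Suc m) = Suc m * (2 * ((2 * m + 1) choose m))"
      using Suc_times_binomial_eq[of "2 * m + 1" m] by (simp add: mult_ac)
    then have C: "(2 * Suc m) choose Suc m = 2 * ((2 * m + 1) choose m)"
      by (simp only: Suc_mult_cancel1)
    have "4 * (2 ^ n)\<^sup>2 = (16 :: nat) ^ Suc m"
      unfolding m by (simp flip: power_mult) (simp add: power_mult power_add)
    also have "\<dots> \<le> 4 * Suc m * ((2 * Suc m) choose Suc m)\<^sup>2"
      by (intro central_binomial_sq_ge) simp
    also have "\<dots> = 4 * (4 * Suc m * ((2 * m + 1) choose m)\<^sup>2)"
      unfolding C power_mult_distrib by simp
    also have "\<dots> \<le> 4 * (4 * n * ((2 * m + 1) choose m)\<^sup>2)"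
      by (intro mult_left_mono mult_right_mono) (auto simp: m)
    also have "\<dots> = 4 * (4 * n * (n choose (n div 2))\<^sup>2)" by (simp add: m)
    finally show ?thesis by simp
  qed
  then have "real ((2 ^ n)\<^sup>2) \<le> real (4 * n * (n choose (n div 2))\<^sup>2)" by (rule of_nat_mono)
  then have "((2 :: real) ^ n)\<^sup>2 \<le> (2 * sqrt (real n) * real (n choose (n div 2)))\<^sup>2"
    by (simp add: power_mult_distrib)
  then show ?thesis by (rule power2_le_imp_le) simp
qed

text \<open>Half a bit for each of \<open>n choose (n div 2)\<close> sets thus stays within the
  target \<open>(n - 1) choose (n div 2)\<close>.\<close>

lemma middle_binomial_le:
  "n choose (n div 2) \<le> 2 * ((n - 1) choose (n div 2))"
proof (cases "n = 0")
  case False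
  have "n * (n choose (n div 2)) \<le> 2 * (n - n div 2) * (n choose (n div 2))"
    by (intro mult_right_mono) auto
  also have "\<dots> = n * (2 * ((n - 1) choose (n div 2)))"
    using binomial_absorb_comp[of n "n div 2"] by simp
  finally show ?thesis using False by simp
qed simp

section \<open>From explicit bounds to limits\<close>

text \<open>The induced matchings give lower bounds without an error term, so only the upper
  estimate carries an \<open>\<epsilon>\<close>.\<close>

lemma asymp_equiv_at_top_epsI:
  fixes f g :: "nat \<Rightarrow> real"
  assumes pos: "eventually (\<lambda>n. g n > 0) at_top" and ge: "eventually (\<lambda>n. g n \<le> f n) at_top"
    and le: "\<And>\<epsilon>. \<epsilon> > 0 \<Longrightarrow> eventually (\<lambda>n. f n \<le> (1 + \<epsilon>) * g n) at_top"
  shows "f \<sim>[at_top] g"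
proof (rule asymp_equivI', rule order_tendstoI)
  fix a :: real assume "a < 1"
  show "eventually (\<lambda>n. a < f n / g n) at_top"
    using pos ge by eventually_elim (use \<open>a < 1\<close> in \<open>simp add: less_le_trans pos_less_divide_eq mult_less_cancel_right1\<close>)
next
  fix a :: real assume a: "1 < a"
  then have "eventually (\<lambda>n. f n \<le> (1 + (a - 1) / 2) * g n) at_top" by (intro le) simp
  then show "eventually (\<lambda>n. f n / g n < a) at_top"
    using pos
  proof eventually_elim
    case (elim n)
    have "(1 + (a - 1) / 2) * g n < a * g n" using a elim(2) by (intro mult_strict_right_mono) (auto simp: field_simps)
    with elim(1) have "f n < a * g n" by (rule le_less_trans)
    then show ?case using elim(2) by (simp add: pos_divide_less_eq)
  qed
qed

text \<open>The cutoff has to be \<open>o(n)\<close>, and the rate \<open>o(1 / sqrt n)\<close> because \<open>2 ^ n\<close> exceeds the middle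
  binomial coefficient by a factor of order \<open>sqrt n\<close>.\<close>

definition degree_cutoff :: "nat \<Rightarrow> nat" where
  "degree_cutoff n = nat \<lceil>real n powr (3 / 4)\<rceil>"

definition branch_rate :: "nat \<Rightarrow> real" where
  "branch_rate n = real n powr (- (9 / 16))"

lemma degree_cutoff_le: "real (degree_cutoff n) \<le> real n powr (3 / 4) + 1"
proof -
  have "0 \<le> \<lceil>real n powr (3 / 4)\<rceil>" by (metis ceiling_mono ceiling_zero powr_ge_zero)
  then show ?thesis unfolding degree_cutoff_def by simp
qed

lemma degree_cutoff_ge: "real n powr (3 / 4) \<le> real (degree_cutoff n)"
  unfolding degree_cutoff_def by linarith

text \<open>The exponent 9/16 lies between 1/2 and 3/4. Rate times cutoff is about n^(3/16), so the
  power of \<open>1 + branch_rate n\<close> grows roughly like exp(n^(3/16)) and outgrows the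
  reciprocal n^(9/16) of the rate.\<close>

lemma eventually_cutoff:
  "eventually (\<lambda>n. branch_rate n > 0 \<and> branch_rate n * (1 + branch_rate n) ^ degree_cutoff n \<ge> 1 \<and>
     degree_cutoff n \<le> n) at_top"
proof -
  have "eventually (\<lambda>n. real n powr (- (9 / 16)) * (1 + real n powr (- (9 / 16))) powr (real n powr (3 / 4)) \<ge> 1) at_top"
    by real_asymp
  moreover have "eventually (\<lambda>n. real n powr (3 / 4) + 1 \<le> real n) at_top" by real_asymp
  ultimately show ?thesis
    using eventually_gt_at_top[of 0]
  proof eventually_elim
    case (elim n)
    have b: "branch_rate n > 0" using elim by (simp add: branch_rate_def)
    have "1 \<le> branch_rate n * (1 + branch_rate n) powr (real n powr (3 / 4))"
      using elim by (simp add: branch_rate_def)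
    also have "\<dots> \<le> branch_rate n * (1 + branch_rate n) powr real (degree_cutoff n)"
      using b degree_cutoff_ge by (intro mult_left_mono powr_mono) auto
    also have "\<dots> = branch_rate n * (1 + branch_rate n) ^ degree_cutoff n"
      using b by (simp add: powr_realpow)
    finally show ?case using b degree_cutoff_le[of n] elim by simp
  qed
qed

lemma log_le_of_bound:
  assumes "1 \<le> M" "real M \<le> (1 + x) ^ K * 2 powr r" "x > 0"
  shows "log 2 (real M) \<le> real K * log 2 (1 + x) + r"
proof -
  have "log 2 (real M) \<le> log 2 ((1 + x) ^ K * 2 powr r)"
    using assms by simp
  also have "\<dots> = real K * log 2 (1 + x) + r"
    using assms by (simp add: log_mult log_nat_power)
  finally show ?thesis .
qed

lemma log_ge_of_two_power_le:
  assumes "2 ^ K \<le> M"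
  shows "real K \<le> log 2 (real M)" "1 \<le> M"
proof -
  show "real K \<le> log 2 (real M)" using assms by (rule le_log2_of_power)
  show "1 \<le> M" using assms by (meson one_le_numeral one_le_power order_trans)
qed

lemma log_mis_hypercube:
  "(\<lambda>n. log 2 (real (mis (hypercube n)))) \<sim>[at_top] (\<lambda>n. 2 powr (real n - 2))"
proof (rule asymp_equiv_at_top_epsI)
  have ge: "real (2 ^ (n - 2)) \<le> log 2 (real (mis (hypercube n)))" "1 \<le> mis (hypercube n)" if "n \<ge> 2" for n
    using log_ge_of_two_power_le[of "2 ^ (n - 2)" "mis (hypercube n)"] num_hypercube_ge[of "{1..n}"] that
    by (simp_all add: mis_hypercube)
  have powr: "2 powr (real n - 2) = 2 ^ (n - 2)" if "n \<ge> 2" for n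
    using that by (simp add: powr_realpow[symmetric] of_nat_diff)
  show "eventually (\<lambda>n. 2 powr (real n - 2) \<le> log 2 (real (mis (hypercube n)))) at_top"
    using eventually_ge_at_top[of 2] by eventually_elim (use ge powr in auto)
  fix \<epsilon> :: real assume \<epsilon>: "\<epsilon> > 0"
  \<comment> \<open>The upper bound in units of \<open>2 ^ (n - 2)\<close>: branching on
    \<open>2 ^ n\<close> vertices contributes the factor 4, the low-degree part the
    quotient.\<close>
  have "((\<lambda>n. 4 * log 2 (1 + real n powr (- (9 / 16))) + 2 * real n / (2 * real n - (real n powr (3 / 4) + 1))) \<longlongrightarrow> 1) at_top"
    by real_asymp
  then have "eventually (\<lambda>n. 4 * log 2 (1 + real n powr (- (9 / 16))) +
      2 * real n / (2 * real n - (real n powr (3 / 4) + 1)) < 1 + \<epsilon>) at_top"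
    using \<epsilon> by (intro order_tendstoD) auto
  moreover have "eventually (\<lambda>n. real n powr (3 / 4) + 1 < 2 * real n) at_top" by real_asymp
  ultimately show "eventually (\<lambda>n. log 2 (real (mis (hypercube n))) \<le> (1 + \<epsilon>) * 2 powr (real n - 2)) at_top"
    using eventually_cutoff eventually_ge_at_top[of 2]
  proof eventually_elim
    case (elim n)
    let ?P = "2 powr (real n - 2)" and ?\<phi> = "degree_cutoff n" and ?L = "log 2 (1 + branch_rate n)"
    have P: "2 ^ n = 4 * ?P" "2 ^ (n - 1) = 2 * ?P"
      using elim(4) by (simp_all add: powr_diff powr_realpow power_diff)
    have "log 2 (real (mis (hypercube n))) \<le>
        real (2 ^ n) * ?L + real (n * 2 ^ (n - 1)) / real (2 * n - ?\<phi>)"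
      using num_hypercube_le[of "{1..n}" "branch_rate n" ?\<phi>] elim ge
      by (intro log_le_of_bound) (auto simp: mis_hypercube)
    also have "\<dots> = (4 * ?L + 2 * real n / real (2 * n - ?\<phi>)) * ?P"
      by (simp add: P(1) P(2)[simplified] algebra_simps)
    also have "\<dots> \<le> (1 + \<epsilon>) * ?P"
    proof (rule mult_right_mono)
      have "2 * real n / real (2 * n - ?\<phi>) \<le> 2 * real n / (2 * real n - (real n powr (3 / 4) + 1))"
        using elim degree_cutoff_le[of n] by (intro divide_left_mono mult_pos_pos) (auto simp: of_nat_diff)
      then show "4 * ?L + 2 * real n / real (2 * n - ?\<phi>) \<le> 1 + \<epsilon>"
        using elim(1) by (simp add: branch_rate_def)
    qed simp
    finally show ?case .
  qed
qed simp

lemma log_mis_two_layers: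
  fixes \<epsilon> :: real
  assumes \<epsilon>: "\<epsilon> > 0"
  shows "eventually (\<lambda>n. \<forall>k<n.
    real ((n - 1) choose k) \<le> log 2 (real (mis (two_layers n k))) \<and>
    log 2 (real (mis (two_layers n k))) \<le> (1 + \<epsilon>) * real ((n - 1) choose k)) at_top"
proof -
  \<comment> \<open>Chosen so that \<open>1 / (1 - \<delta>) = 1 + \<epsilon>\<close>: for
    \<open>k\<close> near an end, one of the layers exceeds the target by at most this
    factor.\<close>
  define \<delta> where "\<delta> = \<epsilon> / (1 + \<epsilon>)"
  have \<delta>: "\<delta> > 0" "\<delta> < 1" "(1 + \<epsilon>) * (1 - \<delta>) = 1"
    using \<epsilon> by (auto simp: \<delta>_def field_simps)
  have "((\<lambda>n. (2 / \<delta>\<^sup>2) * log 2 (1 + real n powr (- (9 / 16))) + real n / (real n + 1 - (real n powr (3 / 4) + 1))) \<longlongrightarrow> (2 / \<delta>\<^sup>2) * 0 + 1) at_top"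
    by (intro tendsto_intros; real_asymp)
  then have "eventually (\<lambda>n. (2 / \<delta>\<^sup>2) * log 2 (1 + real n powr (- (9 / 16))) +
      real n / (real n + 1 - (real n powr (3 / 4) + 1)) < 1 + \<epsilon>) at_top"
    using \<epsilon> by (intro order_tendstoD) auto
  moreover have "eventually (\<lambda>n. real n powr (3 / 4) + 1 < real n + 1) at_top" by real_asymp
  ultimately show ?thesis
    using eventually_cutoff eventually_ge_at_top[of 1]
  proof eventually_elim
    case (elim n)
    show ?case
    proof (intro allI impI)
      fix k assume k: "k < n"
      let ?M = "mis (two_layers n k)" and ?B = "(n - 1) choose k"
      let ?\<phi> = "degree_cutoff n" and ?L = "log 2 (1 + branch_rate n)"
      have ge: "real ?B \<le> log 2 (real ?M)" "1 \<le> ?M"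
        using log_ge_of_two_power_le[of ?B ?M] num_two_layers_ge[of "{1..n}" k] k
        by (simp_all add: mis_two_layers)
      have triv: "log 2 (real ?M) \<le> real (n choose k)" "log 2 (real ?M) \<le> real (n choose (k + 1))"
        using num_two_layers_le_trivial[of "{1..n}" k] ge(2)
        by (auto simp: mis_two_layers intro!: log2_of_power_le)
      have absorb: "(n - k) * (n choose k) = n * ?B" "(k + 1) * (n choose (k + 1)) = n * ?B"
        using binomial_absorb_comp[of n k] times_binomial_minus1_eq[of "k + 1" n] by simp_all
      have easy: "real C \<le> (1 + \<epsilon>) * real ?B" if "m * C = n * ?B" "(1 - \<delta>) * real n \<le> real m" for m C :: nat
      proof -
        have "real n * ((1 - \<delta>) * real C) \<le> real m * real C"
          using mult_right_mono[OF that(2), of "real C"] by (simp add: mult_ac)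
        also have "\<dots> = real n * real ?B" using that(1) by (metis of_nat_mult)
        finally have "(1 - \<delta>) * real C \<le> real ?B" using k by simp
        then have "(1 + \<epsilon>) * ((1 - \<delta>) * real C) \<le> (1 + \<epsilon>) * real ?B"
          using \<epsilon> by (intro mult_left_mono) auto
        then show ?thesis using \<delta>(3) by (simp flip: mult.assoc)
      qed
      have "log 2 (real ?M) \<le> (1 + \<epsilon>) * real ?B"
      proof -
        consider "real (k + 1) < \<delta> * real n" | "real (n - k) < \<delta> * real n"
          | "\<delta> * real n \<le> real (k + 1)" "\<delta> * real n \<le> real (n - k)" by linarith
        then show ?thesis
        proof cases
          case 1
          then have "(1 - \<delta>) * real n \<le> real (n - k)" using k by (simp add: algebra_simps of_nat_diff)
          then show ?thesis using easy[OF absorb(1)] triv(1) by linarith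
        next
          case 2
          then have "(1 - \<delta>) * real n \<le> real (k + 1)" using k by (simp add: algebra_simps of_nat_diff)
          then show ?thesis using easy[OF absorb(2)] triv(2) by linarith
        next
          case 3
          let ?V = "(n + 1) choose (k + 1)"
          \<comment> \<open>Away from the ends the number of vertices is at most a constant times
            the target, so branching is negligible as soon as the rate tends to 0.\<close>
          have V: "real ?V \<le> (2 / \<delta>\<^sup>2) * real ?B"
          proof -
            have "(k + 1) * ?V = (n + 1) * (n choose k)"
              using Suc_times_binomial_eq[of n k] by (simp add: mult.commute)
            then have "(n - k) * ((k + 1) * ?V) = (n + 1) * ((n - k) * (n choose k))"
              by (simp only: mult.left_commute)
            then have "(n - k) * ((k + 1) * ?V) = (n + 1) * (n * ?B)" by (simp only: absorb(1))
            then have eq: "real (n - k) * (real (k + 1) * real ?V) = real (n + 1) * (real n * real ?B)"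
              by (metis of_nat_mult)
            have "(\<delta> * real n) * ((\<delta> * real n) * real ?V) \<le> real (n - k) * (real (k + 1) * real ?V)"
              using 3 \<delta> by (intro mult_mono) auto
            also have "\<dots> \<le> (2 * real n) * (real n * real ?B)"
              unfolding eq using elim by (intro mult_right_mono) auto
            finally have "(real n * real n) * (\<delta>\<^sup>2 * real ?V) \<le> (real n * real n) * (2 * real ?B)"
              by (simp add: mult_ac power2_eq_square)
            then have "\<delta>\<^sup>2 * real ?V \<le> 2 * real ?B" using k by simp
            then show ?thesis using \<delta> by (simp add: field_simps)
          qed
          have L: "?L \<ge> 0" using elim by simp
          have "log 2 (real ?M) \<le> real ?V * ?L + real (n * ?B) / real (n + 1 - ?\<phi>)"
            using num_two_layers_le[of "{1..n}" k "branch_rate n" ?\<phi>] elim ge k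
            by (intro log_le_of_bound) (auto simp: mis_two_layers)
          also have "\<dots> \<le> (2 / \<delta>\<^sup>2) * real ?B * ?L + real n / real (n + 1 - ?\<phi>) * real ?B"
            using mult_right_mono[OF V L] by simp
          also have "\<dots> = ((2 / \<delta>\<^sup>2) * ?L + real n / real (n + 1 - ?\<phi>)) * real ?B"
            by (simp add: algebra_simps)
          also have "\<dots> \<le> (1 + \<epsilon>) * real ?B"
          proof (rule mult_right_mono)
            have "real n / real (n + 1 - ?\<phi>) \<le> real n / (real n + 1 - (real n powr (3 / 4) + 1))"
              using elim degree_cutoff_le[of n] by (intro divide_left_mono mult_pos_pos) (auto simp: of_nat_diff)
            then show "(2 / \<delta>\<^sup>2) * ?L + real n / real (n + 1 - ?\<phi>) \<le> 1 + \<epsilon>"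
              using elim(1) by (simp add: branch_rate_def)
          qed simp
          finally show ?thesis .
        qed
      qed
      then show "real ?B \<le> log 2 (real ?M) \<and> log 2 (real ?M) \<le> (1 + \<epsilon>) * real ?B" using ge by simp
    qed
  qed
qed

lemma log_ma_boolean_algebra:
  "(\<lambda>n. log 2 (real (ma (boolean_algebra n)))) \<sim>[at_top] (\<lambda>n. real ((n - 1) choose (n div 2)))"
proof (rule asymp_equiv_at_top_epsI)
  have ge: "real ((n - 1) choose (n div 2)) \<le> log 2 (real (ma (boolean_algebra n)))" "1 \<le> ma (boolean_algebra n)"
    if "n \<ge> 1" for n
    using log_ge_of_two_power_le[of "(n - 1) choose (n div 2)" "ma (boolean_algebra n)"]
      num_comparable_ge[of "{1..n}" 1 "n div 2"] that
    by (simp_all add: ma_boolean_algebra)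
  show "eventually (\<lambda>n. real ((n - 1) choose (n div 2)) \<le> log 2 (real (ma (boolean_algebra n)))) at_top"
    using eventually_ge_at_top[of 1] by eventually_elim (rule ge)
  show "eventually (\<lambda>n. real ((n - 1) choose (n div 2)) > 0) at_top"
    using eventually_ge_at_top[of 1] by eventually_elim (auto simp: zero_less_binomial_iff)
  fix \<epsilon> :: real assume \<epsilon>: "\<epsilon> > 0"
  define s where "s n = real n powr (3 / 4) + 1" for n :: nat
  \<comment> \<open>Long matchings cost \<open>N / (T + 1)\<close> bits, which is
    \<open>2 / (T + 1)\<close> in units of \<open>N / 2\<close>. \<open>T\<close> is fixed before
    \<open>n\<close> grows.\<close>
  obtain T :: nat where T: "2 / real (T + 1) < \<epsilon>"
  proof -
    obtain T :: nat where "2 / \<epsilon> < real T" using reals_Archimedean2 by blast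
    then have "2 / real (T + 1) < \<epsilon>" using \<epsilon> by (simp add: field_simps)
    then show ?thesis by (rule that)
  qed
  \<comment> \<open>The loss in the chain count with the cutoff replaced by its real upper bound
    \<open>s n\<close>. It vanishes because \<open>s n = o(n)\<close>: covers contribute the first
    power of \<open>s n / n\<close>, other pairs essentially its square.\<close>
  define \<kappa> where "\<kappa> n = 2 * real (T + 1) * (s n / real n) + 16 * 2 ^ T * (s n * (s n + 1) / (real n)\<^sup>2)" for n
  have \<kappa>0: "(\<kappa> \<longlongrightarrow> 2 * real (T + 1) * 0 + 16 * 2 ^ T * 0) at_top"
    unfolding \<kappa>_def s_def by (intro tendsto_add tendsto_mult_left; real_asymp)
  \<comment> \<open>The remaining costs in units of \<open>N / 2\<close>: branching, the
    \<open>n + 1\<close> bits for sets of extreme size, and the hull. The first two use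
    \<open>2 ^ n \<le> 2 * sqrt n * N\<close>.\<close>
  define g where "g n = 4 * sqrt (real n) * log 2 (1 + real n powr (- (9 / 16))) +
      4 * sqrt (real n) * (real n + 1) / 2 ^ n + 1 / (1 - 2 * \<kappa> n)" for n
  have "(g \<longlongrightarrow> 0 + 0 + 1 / (1 - 2 * (2 * real (T + 1) * 0 + 16 * 2 ^ T * 0))) at_top"
    unfolding g_def
  proof (intro tendsto_add tendsto_divide tendsto_diff tendsto_mult_left tendsto_const \<kappa>0)
    show "((\<lambda>n. 4 * sqrt (real n) * log 2 (1 + real n powr (- (9 / 16)))) \<longlongrightarrow> 0) at_top" by real_asymp
    show "((\<lambda>n. 4 * sqrt (real n) * (real n + 1) / 2 ^ n) \<longlongrightarrow> 0) at_top" by real_asymp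
  qed simp
  then have "eventually (\<lambda>n. g n < 1 + \<epsilon> - 2 / real (T + 1)) at_top"
    using T by (intro order_tendstoD) auto
  moreover have "eventually (\<lambda>n. \<kappa> n < 1 / 2) at_top"
    using \<kappa>0 by (rule order_tendstoD) simp
  ultimately show "eventually (\<lambda>n. log 2 (real (ma (boolean_algebra n))) \<le>
      (1 + \<epsilon>) * real ((n - 1) choose (n div 2))) at_top"
    using eventually_cutoff eventually_ge_at_top[of 4]
  proof eventually_elim
    case (elim n)
    let ?\<phi> = "degree_cutoff n" and ?L = "log 2 (1 + branch_rate n)"
    let ?B = "(n - 1) choose (n div 2)"
    define N where "N = real (n choose (n div 2))"
    define \<kappa>' where "\<kappa>' = 2 * real (?\<phi> * (T + 1)) / real n + 16 * real (?\<phi> * ((?\<phi> + 1) * 2 ^ T)) / (real n)\<^sup>2"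
    have "N \<ge> 0" by (simp add: N_def)
    have \<phi>: "real ?\<phi> \<le> s n" using degree_cutoff_le by (simp add: s_def)
    have \<kappa>': "\<kappa>' \<le> \<kappa> n"
    proof -
      have "real ?\<phi> * (real ?\<phi> + 1) \<le> s n * (s n + 1)"
        using \<phi> by (intro mult_mono) auto
      then have "2 * real (T + 1) * (real ?\<phi> / real n) + 16 * 2 ^ T * (real ?\<phi> * (real ?\<phi> + 1) / (real n)\<^sup>2) \<le> \<kappa> n"
        unfolding \<kappa>_def using \<phi> by (intro add_mono mult_left_mono divide_right_mono) auto
      moreover have "\<kappa>' = 2 * real (T + 1) * (real ?\<phi> / real n) + 16 * 2 ^ T * (real ?\<phi> * (real ?\<phi> + 1) / (real n)\<^sup>2)"
        unfolding \<kappa>'_def using elim(4) by (simp add: field_simps)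
      ultimately show ?thesis by simp
    qed
    have L: "?L \<ge> 0" using elim by simp
    have pow: "2 ^ n \<le> 2 * sqrt (real n) * N"
      unfolding N_def using elim by (intro two_power_le_middle_binomial) simp
    have card_n: "card {1..n} = n" by simp
    have "2 * \<kappa>' < 1" using \<kappa>' elim(2) by linarith
    then have "real (cmp.num (Pow {1..n})) \<le> (1 + branch_rate n) ^ (2 ^ n) *
        2 powr ((N / (1 - 2 * \<kappa>') + 2 * real n + 2) / 2 + N / real (T + 1))"
      using elim
      by (intro num_Pow_le[of "{1..n}" "branch_rate n" ?\<phi> T, unfolded card_n, folded \<kappa>'_def N_def]) auto
    then have "log 2 (real (ma (boolean_algebra n))) \<le> real (2 ^ n) * ?L +
        ((N / (1 - 2 * \<kappa>') + 2 * real n + 2) / 2 + N / real (T + 1))"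
      unfolding ma_boolean_algebra[symmetric]
      by (intro log_le_of_bound ge(2)) (use elim in auto)
    also have "\<dots> = 2 ^ n * ?L + N / (1 - 2 * \<kappa>') / 2 + (real n + 1) + N / real (T + 1)"
      by (simp add: add_divide_distrib)
    also have "\<dots> \<le> (2 * sqrt (real n) * N) * ?L + N / (1 - 2 * \<kappa> n) / 2 +
        (real n + 1) * ((2 * sqrt (real n) * N) / 2 ^ n) + N / real (T + 1)"
    proof (intro add_mono order_refl)
      show "2 ^ n * ?L \<le> (2 * sqrt (real n) * N) * ?L" using pow L by (rule mult_right_mono)
      show "N / (1 - 2 * \<kappa>') / 2 \<le> N / (1 - 2 * \<kappa> n) / 2"
        using \<kappa>' elim(2) \<open>N \<ge> 0\<close> by (intro divide_right_mono divide_left_mono mult_pos_pos) auto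
      have "1 \<le> (2 * sqrt (real n) * N) / 2 ^ n" using pow by simp
      then show "real n + 1 \<le> (real n + 1) * ((2 * sqrt (real n) * N) / 2 ^ n)"
        using mult_left_mono[of 1 "(2 * sqrt (real n) * N) / 2 ^ n" "real n + 1"] by simp
    qed
    also have "\<dots> = (g n + 2 / real (T + 1)) * (N / 2)"
      by (simp add: g_def branch_rate_def algebra_simps add_divide_distrib)
    also have "\<dots> \<le> (1 + \<epsilon>) * (N / 2)"
      using elim(1) \<open>N \<ge> 0\<close> by (intro mult_right_mono) auto
    also have "\<dots> \<le> (1 + \<epsilon>) * real ?B"
    proof (rule mult_left_mono)
      have "N \<le> real (2 * ?B)" unfolding N_def using middle_binomial_le by (rule of_nat_mono)
      then show "N / 2 \<le> real ?B" by simp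
    qed (use \<epsilon> in simp)
    finally show ?case .
  qed
qed

theorem theorem1:
  shows "((\<lambda>n. log 2 (real (ma (boolean_algebra n))))
            \<sim>[at_top] (\<lambda>n. real ((n - 1) choose (n div 2)))) \<and>
         ((\<lambda>n. log 2 (real (mis (hypercube n)))) \<sim>[at_top] (\<lambda>n. 2 powr (real n - 2))) \<and>
         (\<forall>\<epsilon>::real > 0. \<exists>n\<^sub>0::nat. \<forall>n \<ge> n\<^sub>0. \<forall>k < n.
            (1 - \<epsilon>) * real ((n - 1) choose k) \<le> log 2 (real (mis (two_layers n k))) \<and>
            log 2 (real (mis (two_layers n k))) \<le> (1 + \<epsilon>) * real ((n - 1) choose k))"
proof (intro conjI log_ma_boolean_algebra log_mis_hypercube allI impI)
  fix \<epsilon> :: real assume \<epsilon>: "\<epsilon> > 0"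
  have "(1 - \<epsilon>) * real m \<le> real m" for m :: nat
    using \<epsilon> by (simp add: algebra_simps)
  then show "\<exists>n\<^sub>0::nat. \<forall>n \<ge> n\<^sub>0. \<forall>k < n.
            (1 - \<epsilon>) * real ((n - 1) choose k) \<le> log 2 (real (mis (two_layers n k))) \<and>
            log 2 (real (mis (two_layers n k))) \<le> (1 + \<epsilon>) * real ((n - 1) choose k)"
    using log_mis_two_layers[OF \<epsilon>] unfolding eventually_at_top_linorder
    by (meson order_trans)
qed

end
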